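(* Let $\alpha\ge -\frac12$. For all $f\in L^1_{\alpha,q}(\mathbb{R}_q)$ and all $x\in\mathbb{R}_q$, $$f(x)=\frac{c_{\alpha,q}}{2}\int_{-\infty}^{+\infty}F_D^{\alpha,q}(f)(\lambda)\,\psi_\lambda^{\alpha,q}(x)\,|\lambda|^{2\alpha+1}\,d_q\lambda=\overline{F_D^{\alpha,q}\big(\overline{F_D^{\alpha,q}(f)}\big)}(x).$$
   Context: Standing assumptions: $q\in(0,1)$ and $\frac{\log(1-q)}{\log q}\in 2\mathbb{Z}$. Functions are complex-valued. $\mathbb{R}_q=\{\pm q^n: n\in\mathbb{Z}\}$. Notation: $(a;q)_\infty=\prod_{k\ge0}(1-aq^k)$, $[x]_q=\frac{1-q^x}{1-q}$, $\Gamma_{q^2}(x)=\frac{(q^2;q^2)_\infty}{(q^{2x};q^2)_\infty}(1-q^2)^{1-x}$, $c_{\alpha,q}=\frac{(1+q)^{-\alpha}}{\Gamma_{q^2}(\alpha+1)}$. $q$-Jackson integral: $\int_{-\infty}^{\infty}f(x)\,d_qx=(1-q)\sum_{n=-\infty}^{\infty}q^n[f(q^n)+f(-q^n)]$ (absolute convergence required). $L^1_{\alpha,q}(\mathbb{R}_q)$ is the space of functions $f$ on $\mathbb{R}_q$ with $\|f\|_{1,\alpha,q}=\int_{-\infty}^\infty|f(x)|\,|x|^{2\alpha+1}d_qx<\infty$. Normalized $q$-Bessel function: $j_\alpha(x;q^2)=\sum_{n\ge0}(-1)^n\frac{\Gamma_{q^2}(\alpha+1)q^{n(n+1)}}{\Gamma_{q^2}(\alpha+n+1)\Gamma_{q^2}(n+1)}\left(\frac{x}{1+q}\right)^{2n}$.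 $q$-Dunkl kernel: $\psi_\lambda^{\alpha,q}(x)=j_\alpha(\lambda x;q^2)+\frac{i\lambda x}{[2\alpha+2]_q}j_{\alpha+1}(\lambda x;q^2)$. $q$-Dunkl transform of $f\in L^1_{\alpha,q}(\mathbb{R}_q)$: $F_D^{\alpha,q}(f)(\lambda)=\frac{c_{\alpha,q}}{2}\int_{-\infty}^{+\infty}f(x)\psi_{-\lambda}^{\alpha,q}(x)|x|^{2\alpha+1}d_qx$, $\lambda\in\mathbb{R}_q$; the same formula is used for any function for which the integral converges absolutely. The bar denotes complex conjugation. *)

theory Defs
  imports "HOL-Analysis.Analysis"
begin

definition R_q :: "real \<Rightarrow> real set" where
  "R_q q = (\<Union>n::int. {q powi n, - (q powi n)})"

definition q_pochhammer_inf :: "real \<Rightarrow> real \<Rightarrow> real" where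
  "q_pochhammer_inf a q = (\<Prod>k. 1 - a * q ^ k)"

definition q_number :: "real \<Rightarrow> real \<Rightarrow> real" where
  "q_number q x = (1 - q powr x) / (1 - q)"

text \<open>The base is the first argument; the base \<open>q\<^sup>2\<close> is what is used below, so that
  \<open>(q\<^sup>2) powr x\<close> is the quantity usually written as \<open>q\<close> to the power \<open>2x\<close>.\<close>

definition q_Gamma :: "real \<Rightarrow> real \<Rightarrow> real" where
  "q_Gamma p x = q_pochhammer_inf p p / q_pochhammer_inf (p powr x) p * (1 - p) powr (1 - x)"

definition c_const :: "real \<Rightarrow> real \<Rightarrow> real" where
  "c_const \<alpha> q = (1 + q) powr (- \<alpha>) / q_Gamma (q\<^sup>2) (\<alpha> + 1)"

text \<open>Integrability means absolute convergence of the values at \<open>q powi n\<close> and at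
  \<open>- (q powi n)\<close> separately: no cancellation between the two half-lines is used. The value
  \<open>jackson_integral\<close> is meaningful for integrable functions only. All functions are total
  on the reals, but only their values on \<open>R_q q\<close> matter.\<close>

definition jackson_integrable :: "real \<Rightarrow> (real \<Rightarrow> 'a::real_normed_vector) \<Rightarrow> bool" where
  "jackson_integrable q f \<longleftrightarrow>
     (\<lambda>n::int. q powi n * (norm (f (q powi n)) + norm (f (- (q powi n))))) summable_on UNIV"

definition jackson_integral :: "real \<Rightarrow> (real \<Rightarrow> 'a::real_normed_vector) \<Rightarrow> 'a" where
  "jackson_integral q f =
     (1 - q) *\<^sub>R (\<Sum>\<^sub>\<infinity>n::int. (q powi n) *\<^sub>R (f (q powi n) + f (- (q powi n))))"

definition L1_q :: "real \<Rightarrow> real \<Rightarrow> (real \<Rightarrow> complex) set" where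
  "L1_q \<alpha> q = {f. jackson_integrable q (\<lambda>x. norm (f x) * \<bar>x\<bar> powr (2 * \<alpha> + 1))}"

definition q_Bessel :: "real \<Rightarrow> real \<Rightarrow> real \<Rightarrow> real" where
  "q_Bessel \<alpha> q x =
     (\<Sum>n. (-1) ^ n * (q_Gamma (q\<^sup>2) (\<alpha> + 1) * q ^ (n * (n + 1)))
            / (q_Gamma (q\<^sup>2) (\<alpha> + real n + 1) * q_Gamma (q\<^sup>2) (real n + 1))
            * (x / (1 + q)) ^ (2 * n))"

definition q_Dunkl_kernel :: "real \<Rightarrow> real \<Rightarrow> real \<Rightarrow> real \<Rightarrow> complex" where
  "q_Dunkl_kernel \<alpha> q \<xi> x =
     of_real (q_Bessel \<alpha> q (\<xi> * x))
     + \<i> * of_real (\<xi> * x) / of_real (q_number q (2 * \<alpha> + 2))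
         * of_real (q_Bessel (\<alpha> + 1) q (\<xi> * x))"

definition q_Dunkl_integrand ::
  "real \<Rightarrow> real \<Rightarrow> (real \<Rightarrow> complex) \<Rightarrow> real \<Rightarrow> real \<Rightarrow> complex" where
  "q_Dunkl_integrand \<alpha> q f \<xi> x =
     f x * q_Dunkl_kernel \<alpha> q (- \<xi>) x * of_real (\<bar>x\<bar> powr (2 * \<alpha> + 1))"

definition q_Dunkl_transform ::
  "real \<Rightarrow> real \<Rightarrow> (real \<Rightarrow> complex) \<Rightarrow> real \<Rightarrow> complex" where
  "q_Dunkl_transform \<alpha> q f \<xi> =
     of_real (c_const \<alpha> q / 2) * jackson_integral q (q_Dunkl_integrand \<alpha> q f \<xi>)"

end

theory Submission
  imports Defs
begin

text \<open>
  Put \<open>p = q\<^sup>2\<close>, \<open>w = p powr (\<alpha> + 1)\<close>. On the lattice the normalised Bessel functions are, up to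
  constants, the Laurent coefficients \<open>A\<^sub>n\<close> of
  \<open>\<Sum> A\<^sub>n z\<^sup>n = (w/z; p)\<^sub>\<infinity> / (z; p)\<^sub>\<infinity>\<close> on \<open>w < \<bar>z\<bar> < 1\<close>; this uses that \<open>1 - q\<close> is an integral power
  of \<open>q\<close>. Replacing \<open>z\<close> by \<open>w/z\<close> inverts the right-hand side, and comparing coefficients in the product of
  the two series gives the orthogonality relation \<open>\<Sum>\<^sub>k w\<^sup>k A\<^bsub>k+m\<^esub> A\<^bsub>k+n\<^esub> = w\<^sup>-\<^sup>n\<close> for \<open>m = n\<close> and \<open>0\<close>
  otherwise. The even part of \<open>f\<close> is inverted with this relation for \<open>\<alpha>\<close>, the odd part with the one for
  \<open>\<alpha> + 1\<close>. The interchange of summations is absolutely convergent, since \<open>A\<close> is bounded and \<open>w\<^sup>k A\<^sub>k\<close>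
  summable over all integers.
\<close>

no_notation Infinite_Set_Sum.abs_summable_on (infix \<open>abs'_summable'_on\<close> 50)

subsection \<open>Infinite q-Pochhammer symbols and Euler's expansion\<close>

lemma convergent_prod_q_pochhammer:
  fixes a p :: real
  assumes "0 < p" "p < 1"
  shows "convergent_prod (\<lambda>k. 1 - a * p ^ k)"
proof -
  have "summable (\<lambda>k. norm ((1 - a * p ^ k) - 1))"
    using assms by (simp add: abs_mult power_abs summable_mult summable_geometric)
  then show ?thesis
    by (simp only: abs_convergent_prod_conv_summable abs_convergent_prod_imp_convergent_prod)
qed

lemma q_pochhammer_inf_LIMSEQ:
  assumes "0 < p" "p < 1"
  shows "(\<lambda>n. \<Prod>k<n. 1 - a * p ^ k) \<longlonglongrightarrow> q_pochhammer_inf a p"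
  unfolding q_pochhammer_inf_def
  using convergent_prod_LIMSEQ[OF convergent_prod_q_pochhammer[OF assms, of a]]
  by (simp add: LIMSEQ_lessThan_iff_atMost)

lemma q_pochhammer_inf_split:
  assumes "0 < p" "p < 1"
  shows "q_pochhammer_inf a p = (\<Prod>k<n. 1 - a * p ^ k) * q_pochhammer_inf (a * p ^ n) p"
proof -
  from has_prod_ignore_initial_segment'[OF convergent_prod_q_pochhammer[OF assms, of a], of n]
  have "prodinf (\<lambda>k. 1 - a * p ^ k) = (\<Prod>k<n. 1 - a * p ^ k) * (\<Prod>k. 1 - a * p ^ (k + n))"
    using has_prod_unique by metis
  then show ?thesis
    unfolding q_pochhammer_inf_def by (simp add: power_add mult_ac)
qed

lemma q_pochhammer_inf_pos:
  assumes "0 < p" "p < 1" "a < 1"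
  shows "0 < q_pochhammer_inf a p"
  unfolding q_pochhammer_inf_def
proof (rule less_0_prodinf[OF convergent_prod_q_pochhammer])
  fix k
  have "a * p ^ k < 1"
  proof (cases "a \<le> 0")
    case True
    with assms have "a * p ^ k \<le> 0" by (simp add: mult_nonpos_nonneg)
    then show ?thesis by linarith
  next
    case False
    with assms have "a * p ^ k \<le> a * 1" by (intro mult_left_mono) (auto simp: power_le_one)
    then show ?thesis using assms by linarith
  qed
  then show "0 < 1 - a * p ^ k" by simp
qed (use assms in auto)

section \<open>Finite q-factorials (p; p)_n and the coefficients of Euler's expansions\<close>

definition q_fact :: "real \<Rightarrow> nat \<Rightarrow> real" where
  "q_fact p n = (\<Prod>k<n. 1 - p ^ Suc k)"

lemma q_fact_0 [simp]: "q_fact p 0 = 1"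
  and q_fact_Suc: "q_fact p (Suc n) = q_fact p n * (1 - p ^ Suc n)"
  by (simp_all add: q_fact_def)

lemma q_fact_pos:
  assumes "0 < p" "p < 1"
  shows "0 < q_fact p n"
  unfolding q_fact_def by (rule prod_pos) (use assms in \<open>auto simp: power_Suc_less_one simp del: power_Suc\<close>)

lemma q_fact_eq:
  assumes "0 < p" "p < 1"
  shows "q_pochhammer_inf p p = q_fact p n * q_pochhammer_inf (p ^ Suc n) p"
  using q_pochhammer_inf_split[OF assms, of p n] by (simp add: q_fact_def)

lemma q_pochhammer_inf_le_1:
  assumes "0 < p" "p < 1" "0 \<le> a" "a \<le> 1"
  shows "q_pochhammer_inf a p \<le> 1"
proof (rule LIMSEQ_le_const2[OF q_pochhammer_inf_LIMSEQ])
  have "a * p ^ k \<le> 1" for k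
    using assms by (simp add: mult_le_one power_le_one)
  then show "\<exists>N. \<forall>n\<ge>N. (\<Prod>k<n. 1 - a * p ^ k) \<le> 1"
    using assms by (auto intro!: prod_le_1)
qed (use assms in auto)

text \<open>The tail by which the infinite product exceeds \<open>q_fact p n\<close> is at most 1.
  The bound is uniform in \<open>n\<close>, so it bounds all reciprocals
  \<open>1 / q_fact p n\<close> at once.\<close>

lemma q_fact_ge:
  assumes "0 < p" "p < 1"
  shows "q_pochhammer_inf p p \<le> q_fact p n"
proof -
  have "q_pochhammer_inf (p ^ Suc n) p \<le> 1"
    using assms by (intro q_pochhammer_inf_le_1) (auto intro: power_le_one simp del: power_Suc)
  then show ?thesis
    using q_fact_eq[OF assms, of n] q_fact_pos[OF assms, of n]
    by (simp add: mult_left_le)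
qed

text \<open>Power series coefficients of the infinite product (x; p)_inf, see
  \<open>euler_sums\<close>. Those of its reciprocal are \<open>1 / q_fact p k\<close>, see
  \<open>euler_coeff_convolution\<close>.\<close>

definition euler_coeff :: "real \<Rightarrow> nat \<Rightarrow> real" where
  "euler_coeff p k = (-1) ^ k * p ^ (k choose 2) / q_fact p k"

lemma Suc_choose_2: "Suc k choose 2 = k + (k choose 2)"
  by (simp add: numeral_2_eq_2)

lemma euler_coeff_0 [simp]: "euler_coeff p 0 = 1"
  by (simp add: euler_coeff_def numeral_2_eq_2)

lemma euler_coeff_Suc:
  "euler_coeff p (Suc k) = euler_coeff p k * (- (p ^ k) / (1 - p ^ Suc k))"
  by (simp add: euler_coeff_def Suc_choose_2 q_fact_Suc power_add)

lemma summable_euler: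
  assumes "0 < p" "p < 1"
  shows "summable (\<lambda>k. norm (euler_coeff p k * x ^ k))"
proof -
  \<comment> \<open>This null sequence dominates the ratios of consecutive terms, so the series
    converges for every \<open>x\<close>.\<close>
  have "(\<lambda>k. \<bar>x\<bar> * p ^ k / (1 - p)) \<longlonglongrightarrow> \<bar>x\<bar> * 0 / (1 - p)"
    using assms by (intro tendsto_intros LIMSEQ_power_zero) auto
  then have "eventually (\<lambda>k. \<bar>x\<bar> * p ^ k / (1 - p) < 1 / 2) sequentially"
    by (rule order_tendstoD) simp
  then obtain N where N: "\<And>k. k \<ge> N \<Longrightarrow> \<bar>x\<bar> * p ^ k / (1 - p) < 1 / 2"
    by (auto simp: eventually_sequentially)
  show ?thesis
  proof (rule summable_ratio_test[of "1 / 2" N])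
    fix k assume "N \<le> k"
    have lt: "p ^ Suc k \<le> p" "p ^ Suc k < 1"
      using assms by (auto simp: power_Suc_less_one mult_left_le power_le_one simp del: power_Suc) (simp add: mult_left_le power_le_one)
    have "norm (euler_coeff p (Suc k) * x ^ Suc k)
        = norm (euler_coeff p k * x ^ k) * (\<bar>x\<bar> * p ^ k / (1 - p ^ Suc k))"
      using assms lt by (simp add: euler_coeff_Suc abs_mult del: power_Suc) (simp add: abs_mult)
    also have "\<dots> \<le> norm (euler_coeff p k * x ^ k) * (1 / 2)"
    proof (rule mult_left_mono)
      have "\<bar>x\<bar> * p ^ k / (1 - p ^ Suc k) \<le> \<bar>x\<bar> * p ^ k / (1 - p)"
        using assms lt by (intro divide_left_mono) (auto simp del: power_Suc)
      also have "\<dots> \<le> 1 / 2" using N[OF \<open>N \<le> k\<close>] by simp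
      finally show "\<bar>x\<bar> * p ^ k / (1 - p ^ Suc k) \<le> 1 / 2" .
    qed simp
    finally show "norm (norm (euler_coeff p (Suc k) * x ^ Suc k))
        \<le> 1 / 2 * norm (norm (euler_coeff p k * x ^ k))"
      by (simp only: real_norm_def abs_idempotent mult.commute[of "1 / 2"])
  qed simp
qed

text \<open>The power series F satisfies the functional equation F(y) = (1 - y) F(y p) of the
  infinite product. Iteration splits off the finite products, and continuity at 0 together with F(0)
  = 1 sends the remaining factor to 1.\<close>

lemma euler_sums:
  assumes p: "0 < p" "p < 1"
  shows "(\<lambda>k. euler_coeff p k * x ^ k) sums q_pochhammer_inf x p"
proof -
  define F where "F = (\<lambda>x. \<Sum>k. euler_coeff p k * x ^ k)"
  have smb: "summable (\<lambda>k. euler_coeff p k * y ^ k)" for y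
    by (rule summable_norm_cancel[OF summable_euler[OF p]])
  have nz: "1 - p ^ Suc k \<noteq> 0" for k
    using p power_Suc_less_one[of p k] by simp
  have step: "F y = (1 - y) * F (y * p)" for y
  proof -
    have "F y - F (y * p) = (\<Sum>k. euler_coeff p k * y ^ k - euler_coeff p k * (y * p) ^ k)"
      unfolding F_def by (rule suminf_diff[OF smb smb])
    also have "\<dots> = (\<Sum>k. euler_coeff p (Suc k) * y ^ Suc k * (1 - p ^ Suc k))"
      using suminf_split_head[OF summable_diff[OF smb[of y] smb[of "y * p"]]]
      by (simp add: right_diff_distrib power_mult_distrib mult_ac)
    also have "\<dots> = (\<Sum>k. (- y) * (euler_coeff p k * (y * p) ^ k))"
    proof (rule suminf_cong)
      fix k
      show "euler_coeff p (Suc k) * y ^ Suc k * (1 - p ^ Suc k) = - y * (euler_coeff p k * (y * p) ^ k)"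
        using nz[of k] unfolding euler_coeff_Suc power_mult_distrib
        by (simp del: power_Suc) simp
    qed
    also have "\<dots> = - y * F (y * p)"
      unfolding F_def by (rule suminf_mult[OF smb])
    finally show ?thesis by (simp add: algebra_simps)
  qed
  have iter: "F x = (\<Prod>k<n. 1 - x * p ^ k) * F (x * p ^ n)" for n
  proof (induction n)
    case (Suc n)
    have "F (x * p ^ n) = (1 - x * p ^ n) * F (x * p ^ Suc n)"
      using step[of "x * p ^ n"] by (simp only: power_Suc2 mult.assoc)
    then show ?case using Suc by (simp add: mult.assoc del: power_Suc)
  qed simp
  have "isCont F 0"
    unfolding F_def by (rule isCont_powser[where K = 1]) (use smb[of 1] in auto)
  moreover have "(\<lambda>n. x * p ^ n) \<longlonglongrightarrow> 0"
    using p by (intro tendsto_mult_right_zero LIMSEQ_power_zero) auto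
  ultimately have "(\<lambda>n. F (x * p ^ n)) \<longlonglongrightarrow> F 0"
    using isCont_tendsto_compose by blast
  then have "(\<lambda>n. (\<Prod>k<n. 1 - x * p ^ k) * F (x * p ^ n)) \<longlonglongrightarrow> q_pochhammer_inf x p * F 0"
    by (intro tendsto_mult q_pochhammer_inf_LIMSEQ p)
  then have "(\<lambda>n::nat. F x) \<longlonglongrightarrow> q_pochhammer_inf x p * F 0"
    by (simp only: iter[symmetric])
  moreover have "F 0 = 1"
    unfolding F_def by simp
  ultimately have "F x = q_pochhammer_inf x p"
    by (simp add: LIMSEQ_const_iff)
  then show ?thesis
    using smb[of x] unfolding F_def by (simp add: sums_iff)
qed

text \<open>The rational identity behind the induction step of
  \<open>euler_coeff_partial_sum\<close>, with \<open>u = p ^ Suc m\<close>,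
  \<open>v = p ^ Suc k\<close> and \<open>pn = p ^ n\<close>. It rests on 1 - pn = (1 - v) + v (1 -
  u).\<close>

lemma telescoping_fraction:
  fixes a c g u v pn :: real
  assumes "1 - u \<noteq> 0" "1 - v \<noteq> 0" "g \<noteq> 0" "pn = v * u"
    "1 - pn \<noteq> 0"
  shows "c * a / (g * (1 - u) * (1 - pn)) + c * (- a / (1 - v)) / (g * (1 - u))
    = c * (- a / (1 - v)) * v / (g * (1 - pn))"
proof -
  define U V W where "U = 1 - u" and "V = 1 - v" and "W = 1 - pn"
  have "V - W = - (v * U)"
    unfolding U_def V_def W_def assms(4) by (simp add: algebra_simps)
  then have W: "W = V + v * U" by simp
  have nz: "U \<noteq> 0" "V \<noteq> 0" "V + v * U \<noteq> 0"
    using assms W by (auto simp: U_def V_def W_def)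
  have "c * a / (g * U * W) + c * (- a / V) / (g * U) = c * (- a / V) * v / (g * W)"
    unfolding W using nz assms(3) by (simp add: divide_simps) (simp add: algebra_simps)
  then show ?thesis unfolding U_def V_def W_def .
qed

text \<open>A closed form for the partial sums makes the convolution below accessible to induction
  on \<open>k\<close>. At \<open>k = n - 1\<close> it is the negative of the last term of the full
  convolution.\<close>

lemma euler_coeff_partial_sum:
  assumes p: "0 < p" "p < 1" and "k < n"
  shows "(\<Sum>i\<le>k. euler_coeff p i / q_fact p (n - i))
    = euler_coeff p k * p ^ k / (q_fact p (n - Suc k) * (1 - p ^ n))"
  using \<open>k < n\<close>
proof (induction k)
  case 0
  then obtain m where "n = Suc m" using gr0_implies_Suc by blast
  then show ?case by (simp add: q_fact_Suc)
next
  case (Suc k)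
  then obtain m where n: "n = k + Suc (Suc m)"
    using less_imp_Suc_add[of "Suc k" n] by auto
  have nz: "1 - p ^ Suc j \<noteq> 0" for j
    using p power_Suc_less_one[of p j] by simp
  have nz': "1 - p ^ n \<noteq> 0" "1 - p ^ Suc m \<noteq> 0" "1 - p ^ Suc k \<noteq> 0" "q_fact p m \<noteq> 0"
    using nz[of "k + Suc m"] nz q_fact_pos[OF p, of m] n by auto
  have s: "n - Suc k = Suc m" "n - Suc (Suc k) = m" using n by auto
  have pn: "p ^ n = p ^ Suc k * p ^ Suc m" unfolding n by (simp add: power_add)
  have "(\<Sum>i\<le>Suc k. euler_coeff p i / q_fact p (n - i))
    = euler_coeff p k * p ^ k / (q_fact p m * (1 - p ^ Suc m) * (1 - p ^ n))
      + euler_coeff p k * (- (p ^ k) / (1 - p ^ Suc k)) / (q_fact p m * (1 - p ^ Suc m))"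
    using Suc by (simp only: sum.atMost_Suc s q_fact_Suc euler_coeff_Suc)
  also have "\<dots> = euler_coeff p k * (- (p ^ k) / (1 - p ^ Suc k)) * p ^ Suc k
      / (q_fact p m * (1 - p ^ n))"
    using nz' pn
    by (intro telescoping_fraction)
  finally show ?case by (simp only: s euler_coeff_Suc)
qed

text \<open>Coefficient form of the statement that (z; p)_inf and its reciprocal multiply to
  1.\<close>

lemma euler_coeff_convolution:
  assumes p: "0 < p" "p < 1"
  shows "(\<Sum>i\<le>n. euler_coeff p i / q_fact p (n - i)) = (if n = 0 then 1 else 0)"
proof (cases n)
  case (Suc m)
  have "1 - p ^ Suc m \<noteq> 0"
    using p power_Suc_less_one[of p m] by simp
  then show ?thesis
    using euler_coeff_partial_sum[OF p, of m n] Suc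
    by (simp add: euler_coeff_Suc q_fact_Suc del: power_Suc)
qed simp

subsection \<open>Absolutely summable families over the integers\<close>

lemma infsum_shift_int:
  fixes f :: "int \<Rightarrow> 'a::{comm_monoid_add, t2_space}"
  shows "(\<Sum>\<^sub>\<infinity>n. f (n + c)) = (\<Sum>\<^sub>\<infinity>n. f n)"
  by (rule infsum_reindex_bij_witness[where j = "\<lambda>n. n + c" and i = "\<lambda>n. n - c"]) auto

lemma summable_on_shift_int:
  fixes f :: "int \<Rightarrow> 'a::{comm_monoid_add, t2_space}"
  shows "(\<lambda>n. f (n + c)) summable_on UNIV \<longleftrightarrow> f summable_on UNIV"
  by (rule summable_on_reindex_bij_witness[where j = "\<lambda>n. n + c" and i = "\<lambda>n. n - c"]) auto

lemma abs_summable_mult_pair: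
  fixes u :: "'a \<Rightarrow> 'c::real_normed_field" and v :: "'b \<Rightarrow> 'c"
  assumes "u abs_summable_on UNIV" "v abs_summable_on UNIV"
  shows "(\<lambda>(i, j). u i * v j) abs_summable_on UNIV \<times> UNIV"
  unfolding Infinite_Sum.abs_summable_on_Sigma_iff using assms
  by (auto simp: norm_mult abs_mult infsum_cmult_right' intro!: summable_on_cmult_right summable_on_cmult_left)

lemma infsum_mult_pair:
  fixes u :: "'a \<Rightarrow> real" and v :: "'b \<Rightarrow> real"
  assumes "u abs_summable_on UNIV" "v abs_summable_on UNIV"
  shows "(\<Sum>\<^sub>\<infinity>(i, j). u i * v j) = (\<Sum>\<^sub>\<infinity>i. u i) * (\<Sum>\<^sub>\<infinity>j. v j)"
proof -
  have "(\<Sum>\<^sub>\<infinity>(i, j)\<in>UNIV \<times> UNIV. u i * v j) = (\<Sum>\<^sub>\<infinity>i. \<Sum>\<^sub>\<infinity>j. u i * v j)"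
    using infsum_Sigma_banach[OF abs_summable_summable[OF abs_summable_mult_pair[OF assms]]] by simp
  then show ?thesis
    by (simp add: infsum_cmult_right' infsum_cmult_left')
qed

text \<open>By shift invariance the sum of \<bar>e\<bar> over \<open>n\<close> does not depend on
  \<open>x\<close>, so the iterated sum without \<open>h\<close> factors; the bounded
  \<open>h\<close> only costs a constant. This justifies the interchanges of summation for
  correlations.\<close>

lemma abs_summable_shifted_family:
  fixes G :: "'i \<Rightarrow> real" and e :: "int \<Rightarrow> real"
  assumes G: "G abs_summable_on UNIV" and e: "e abs_summable_on UNIV"
    and h: "\<And>x n. \<bar>h x n\<bar> \<le> B"
  shows "(\<lambda>(x, n). G x * e (n + \<sigma> x) * h x n) abs_summable_on UNIV \<times> UNIV"
proof (rule Infinite_Sum.abs_summable_on_comparison_test)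
  have "(\<lambda>(x, n). G x * e (n + \<sigma> x)) abs_summable_on UNIV \<times> UNIV"
    unfolding Infinite_Sum.abs_summable_on_Sigma_iff
  proof (intro conjI ballI)
    fix x
    have "(\<lambda>n. \<bar>e (n + \<sigma> x)\<bar>) summable_on UNIV"
      using e summable_on_shift_int[of "\<lambda>n. \<bar>e n\<bar>" "\<sigma> x"] by simp
    then show "(\<lambda>y. case (x, y) of (x, n) \<Rightarrow> G x * e (n + \<sigma> x)) abs_summable_on UNIV"
      by (simp add: abs_mult summable_on_cmult_right)
  next
    have "(\<Sum>\<^sub>\<infinity>n. \<bar>e (n + c)\<bar>) = (\<Sum>\<^sub>\<infinity>n. \<bar>e n\<bar>)" for c
      by (rule infsum_shift_int)
    then show "(\<lambda>x. \<Sum>\<^sub>\<infinity>y. norm (case (x, y) of (x, n) \<Rightarrow> G x * e (n + \<sigma> x))) abs_summable_on UNIV"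
      using G by (simp add: abs_mult infsum_cmult_right' summable_on_cmult_left)
  qed
  from summable_on_cmult_right[OF this, of "\<bar>B\<bar>"]
  show "(\<lambda>(x, n). B * (G x * e (n + \<sigma> x))) abs_summable_on UNIV \<times> UNIV"
    by (simp add: case_prod_unfold abs_mult summable_on_cmult_right)
next
  fix xn :: "'i \<times> int"
  obtain x n where [simp]: "xn = (x, n)" by fastforce
  have "\<bar>G x * e (n + \<sigma> x)\<bar> * \<bar>h x n\<bar> \<le> \<bar>G x * e (n + \<sigma> x)\<bar> * \<bar>B\<bar>"
    using h[of x n] by (intro mult_left_mono) auto
  then show "norm (case xn of (x, n) \<Rightarrow> G x * e (n + \<sigma> x) * h x n)
      \<le> norm (case xn of (x, n) \<Rightarrow> B * (G x * e (n + \<sigma> x)))"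
    by (simp add: abs_mult mult_ac)
qed

lemma abs_summable_bounded:
  fixes e :: "'a \<Rightarrow> real"
  assumes "e abs_summable_on UNIV"
  obtains B where "\<And>n. \<bar>e n\<bar> \<le> B"
proof
  fix n
  show "\<bar>e n\<bar> \<le> (\<Sum>\<^sub>\<infinity>n. norm (e n))"
    using finite_sum_le_infsum[OF assms, of "{n}"] by simp
qed

lemma abs_summable_correlation:
  fixes g :: "nat \<Rightarrow> real" and e :: "int \<Rightarrow> real"
  assumes "g abs_summable_on UNIV" "e abs_summable_on UNIV"
  shows "(\<lambda>n. \<Sum>\<^sub>\<infinity>i. g i * e (n + int i)) abs_summable_on UNIV"
proof -
  have "(\<lambda>(i, n). g i * e (n + int i) * 1) abs_summable_on UNIV \<times> UNIV"
    by (rule abs_summable_shifted_family[OF assms, where B = 1]) simp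
  then have "(\<lambda>(i, n). g i * e (n + int i)) summable_on UNIV \<times> UNIV"
    using abs_summable_summable by fastforce
  then have "(\<lambda>(n, i). g i * e (n + int i)) summable_on UNIV \<times> UNIV"
    by (subst summable_on_swap) simp
  from summable_on_Sigma_banach[OF this]
  show ?thesis by (simp only: summable_on_iff_abs_summable_on_real[symmetric])
qed

text \<open>The product \<open>h (n + l) * h n\<close> is a double sum over \<open>i\<close>, \<open>j\<close>; the substitution \<open>t = n + i + j\<close>
  decouples it into a product of two convolutions of \<open>g\<close> with \<open>e\<close>.\<close>

lemma correlation_orthogonality:
  fixes g :: "nat \<Rightarrow> real" and e :: "int \<Rightarrow> real"
  assumes g: "g abs_summable_on UNIV" and e: "e abs_summable_on UNIV"
    and inverse: "\<And>t. (\<Sum>\<^sub>\<infinity>i. g i * e (t - int i)) = (if t = 0 then 1 else 0)"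
  defines "h \<equiv> \<lambda>n. \<Sum>\<^sub>\<infinity>i. g i * e (n + int i)"
  shows "(\<Sum>\<^sub>\<infinity>n. h (n + l) * h n) = (if l = 0 then 1 else 0)"
proof -
  obtain B where B: "\<And>n. \<bar>e n\<bar> \<le> B"
    using abs_summable_bounded[OF e] by blast
  have gg: "(\<lambda>(i, j). g i * g j) abs_summable_on UNIV"
    using abs_summable_mult_pair[OF g g] by simp
  \<comment> \<open>\<open>H\<close> and \<open>K\<close> are written in the shape of
    \<open>abs_summable_shifted_family\<close> with the pair as index: one factor \<open>e\<close>
    is shifted by an amount depending on the pair, the other one is merely bounded. \<open>K\<close>
    is \<open>H\<close> after the substitution.\<close>
  define H where "H = (\<lambda>(i, j) n. (case (i, j) of (i, j) \<Rightarrow> g i * g j) * e (n + (case (i, j) of (i, j) \<Rightarrow> l + int i)) * e (n + int j))"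
  define K where "K = (\<lambda>(i, j) t. (case (i, j) of (i, j) \<Rightarrow> g i * g j) * e (t + (case (i, j) of (i, j) \<Rightarrow> l - int j)) * e (t - int i))"
  have sm: "(\<lambda>(x, n). H x n) summable_on UNIV \<times> UNIV" "(\<lambda>(x, n). K x n) summable_on UNIV \<times> UNIV"
    using abs_summable_summable[OF abs_summable_shifted_family[OF gg e,
        where B = B and h = "\<lambda>(i, j) n. e (n + int j)" and \<sigma> = "\<lambda>(i, j). l + int i"]]
      abs_summable_summable[OF abs_summable_shifted_family[OF gg e,
        where B = B and h = "\<lambda>(i, j) n. e (n - int i)" and \<sigma> = "\<lambda>(i, j). l - int j"]] B
    by (auto simp: H_def K_def case_prod_unfold)
  have ge: "(\<lambda>i. g i * e (f i)) abs_summable_on UNIV" for f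
  proof (rule Infinite_Sum.abs_summable_on_comparison_test)
    show "(\<lambda>i. B * g i) abs_summable_on UNIV"
      using g by (simp add: abs_mult summable_on_cmult_right)
    fix i show "norm (g i * e (f i)) \<le> norm (B * g i)"
      using B[of "f i"] by (simp add: abs_mult mult.commute[of B] mult_left_mono mult_right_mono)
  qed
  have "(\<Sum>\<^sub>\<infinity>n. h (n + l) * h n) = (\<Sum>\<^sub>\<infinity>n. \<Sum>\<^sub>\<infinity>x. H x n)"
    unfolding h_def infsum_mult_pair[OF ge ge, symmetric]
    by (intro infsum_cong) (simp add: H_def case_prod_unfold mult_ac add_ac)
  also have "\<dots> = (\<Sum>\<^sub>\<infinity>x. \<Sum>\<^sub>\<infinity>n. H x n)"
    by (rule infsum_swap_banach[symmetric, OF sm(1)])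
  also have "\<dots> = (\<Sum>\<^sub>\<infinity>x. \<Sum>\<^sub>\<infinity>t. K x t)"
  proof (rule infsum_cong)
    fix x :: "nat \<times> nat"
    have "H x n = K x (n + int (fst x + snd x))" for n
      by (simp add: H_def K_def case_prod_unfold algebra_simps)
    then show "(\<Sum>\<^sub>\<infinity>n. H x n) = (\<Sum>\<^sub>\<infinity>t. K x t)"
      by (simp only: infsum_shift_int)
  qed
  also have "\<dots> = (\<Sum>\<^sub>\<infinity>t. \<Sum>\<^sub>\<infinity>x. K x t)"
    by (rule infsum_swap_banach[OF sm(2)])
  also have "\<dots> = (\<Sum>\<^sub>\<infinity>t. (\<Sum>\<^sub>\<infinity>i. g i * e (t - int i)) * (\<Sum>\<^sub>\<infinity>j. g j * e ((t + l) - int j)))"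
    unfolding infsum_mult_pair[OF ge ge, symmetric]
    by (intro infsum_cong) (simp add: K_def case_prod_unfold mult_ac algebra_simps)
  \<comment> \<open>By \<open>inverse\<close> the first factor is the delta at \<open>t = 0\<close>
    and the second the delta at \<open>t + l = 0\<close>.\<close>
  also have "\<dots> = (\<Sum>\<^sub>\<infinity>t\<in>{0::int}. if l = 0 then 1 else 0)"
    unfolding inverse by (intro infsum_cong_neutral) auto
  finally show ?thesis by simp
qed

subsection \<open>Bessel sequences and their orthogonality\<close>

text \<open>Extension by zero to negative integers, as for a reciprocal Gamma function at its poles.
  Thus all Laurent coefficients of 1 / (z; p)_inf on \<bar>z\<bar> < 1 form one sequence.\<close>

definition inv_q_fact :: "real \<Rightarrow> int \<Rightarrow> real" where
  "inv_q_fact p n = (if n < 0 then 0 else 1 / q_fact p (nat n))"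

lemma q_pochhammer_inf_powi:
  assumes p: "0 < p" "p < 1"
  shows "q_pochhammer_inf (p powi (n + 1)) p = q_pochhammer_inf p p * inv_q_fact p n"
proof (cases "n < 0")
  case True
  \<comment> \<open>For negative \<open>n\<close> the factor of the product with index
    \<open>- n - 1\<close> is zero.\<close>
  have "p powi (n + 1) * p ^ nat (- n - 1) = p powi (n + 1 + int (nat (- n - 1)))"
    using p power_int_add[of p "n + 1" "int (nat (- n - 1))"]
    by (simp only: power_int_of_nat less_imp_neq[THEN not_sym] simp_thms)
  also have "\<dots> = 1" using True by simp
  finally have "q_pochhammer_inf (p powi (n + 1)) p = 0"
    using q_pochhammer_inf_split[OF p, of "p powi (n + 1)" "Suc (nat (- n - 1))"] by simp
  then show ?thesis using True by (simp add: inv_q_fact_def)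
next
  case False
  then have "n + 1 = int (Suc (nat n))" by simp
  then have "p powi (n + 1) = p ^ Suc (nat n)" by (simp only: power_int_of_nat)
  then show ?thesis
    using q_fact_eq[OF p, of "nat n"] q_fact_pos[OF p, of "nat n"] False
    by (simp add: inv_q_fact_def)
qed

lemma inv_q_fact_bounds:
  assumes p: "0 < p" "p < 1"
  shows "0 \<le> inv_q_fact p n" "inv_q_fact p n \<le> 1 / q_pochhammer_inf p p"
  using q_fact_pos[OF p] q_fact_ge[OF p] q_pochhammer_inf_pos[OF p p(2)]
  by (auto simp: inv_q_fact_def less_imp_le intro!: divide_left_mono mult_pos_pos)

lemma abs_summable_inv_q_fact:
  assumes p: "0 < p" "p < 1" and z: "0 < z" "z < 1"
  shows "(\<lambda>n. z powi n * inv_q_fact p n) abs_summable_on UNIV"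
proof -
  have "summable (\<lambda>n. z ^ n * (1 / q_pochhammer_inf p p))"
    using z by (intro summable_mult2 summable_geometric) auto
  then have "summable (\<lambda>n. norm (norm (z ^ n * inv_q_fact p (int n))))"
  proof (rule summable_comparison_test'[where N = 0])
    fix n
    show "norm (norm (norm (z ^ n * inv_q_fact p (int n)))) \<le> z ^ n * (1 / q_pochhammer_inf p p)"
      using inv_q_fact_bounds[OF p, of "int n"] z
      by (simp only: real_norm_def abs_idempotent abs_mult) (intro mult_mono, auto)
  qed
  then have "(\<lambda>n. norm (z ^ n * inv_q_fact p (int n))) summable_on UNIV"
    by (rule norm_summable_imp_summable_on)
  then have "((\<lambda>n. norm (z powi n * inv_q_fact p n)) \<circ> int) summable_on UNIV"
    by (simp add: o_def)
  then have "(\<lambda>n. norm (z powi n * inv_q_fact p n)) summable_on range int"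
    by (subst summable_on_reindex) auto
  then show ?thesis
  proof (rule summable_on_cong_neutral[THEN iffD1, rotated -1])
    fix n assume "n \<in> UNIV - range int"
    then have "n < 0" by (metis DiffD2 nonneg_int_cases not_less range_eqI)
    then show "norm (z powi n * inv_q_fact p n) = 0" by (simp add: inv_q_fact_def)
  qed auto
qed

lemma abs_summable_euler:
  assumes "0 < p" "p < 1"
  shows "(\<lambda>k. euler_coeff p k * x ^ k) abs_summable_on UNIV"
  using norm_summable_imp_summable_on[of "\<lambda>k. norm (euler_coeff p k * x ^ k)"]
    summable_euler[OF assms, of x] by simp

lemma infsum_euler:
  assumes "0 < p" "p < 1"
  shows "(\<Sum>\<^sub>\<infinity>k. euler_coeff p k * x ^ k) = q_pochhammer_inf x p"
  using norm_summable_imp_has_sum[OF summable_euler[OF assms] euler_sums[OF assms]]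
  by (rule infsumI)

text \<open>Up to normalisation, \<open>bessel_seq p w n\<close> is the Hahn--Exton $q$-Bessel function at the
  $n$-th lattice point. It is the Laurent coefficient of \<open>z\<^sup>n\<close> in
  \<open>(w/z; p)\<^sub>\<infinity> / (z; p)\<^sub>\<infinity>\<close>.\<close>

definition bessel_seq :: "real \<Rightarrow> real \<Rightarrow> int \<Rightarrow> real" where
  "bessel_seq p w n = (\<Sum>\<^sub>\<infinity>j. euler_coeff p j * w ^ j * inv_q_fact p (n + int j))"

text \<open>The parameter \<open>z\<close> distributes geometric weights over the two factors. For 0
  < z < 1 both become absolutely summable, and the sum is a correlation as in
  \<open>correlation_orthogonality\<close>.\<close>

lemma bessel_seq_scaled:
  assumes "z \<noteq> 0"
  shows "z powi n * bessel_seq p w n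
    = (\<Sum>\<^sub>\<infinity>i. (euler_coeff p i * (w / z) ^ i) * (z powi (n + int i) * inv_q_fact p (n + int i)))"
  unfolding bessel_seq_def infsum_cmult_right'[symmetric]
  using assms by (intro infsum_cong) (simp add: power_int_add power_divide)

text \<open>\<open>z powi n\<close> grows as \<open>n\<close> tends to minus infinity, so this
  includes decay of \<open>bessel_seq\<close> in that direction; a correlation of two absolutely
  summable families is summable in both directions.\<close>

lemma abs_summable_bessel_seq:
  assumes p: "0 < p" "p < 1" and z: "0 < z" "z < 1"
  shows "(\<lambda>n. z powi n * bessel_seq p w n) abs_summable_on UNIV"
proof -
  have "z \<noteq> 0" using z by simp
  show ?thesis
    unfolding bessel_seq_scaled[OF \<open>z \<noteq> 0\<close>]
    by (rule abs_summable_correlation[OF abs_summable_euler[OF p] abs_summable_inv_q_fact[OF p z]])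
qed

lemma bessel_seq_bounded:
  assumes p: "0 < p" "p < 1"
  obtains B where "\<And>n. \<bar>bessel_seq p w n\<bar> \<le> B"
proof
  fix n
  let ?P = "q_pochhammer_inf p p"
  have le: "norm (euler_coeff p j * w ^ j * inv_q_fact p (n + int j))
      \<le> norm (euler_coeff p j * w ^ j * (1 / ?P))" for j
    using inv_q_fact_bounds[OF p, of "n + int j"] q_pochhammer_inf_pos[OF p p(2)]
    by (simp only: norm_mult) (intro mult_left_mono, auto)
  have sm: "(\<lambda>j. euler_coeff p j * w ^ j * (1 / ?P)) abs_summable_on UNIV"
    using abs_summable_euler[OF p, of w] by (simp only: norm_mult summable_on_cmult_left)
  then have "(\<lambda>j. euler_coeff p j * w ^ j * inv_q_fact p (n + int j)) abs_summable_on UNIV"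
    by (rule Infinite_Sum.abs_summable_on_comparison_test) (rule le)
  from norm_infsum_bound[OF this] infsum_mono[OF this sm le]
  show "\<bar>bessel_seq p w n\<bar> \<le> (\<Sum>\<^sub>\<infinity>j. norm (euler_coeff p j * w ^ j * (1 / ?P)))"
    unfolding bessel_seq_def by simp
qed

text \<open>\<open>euler_coeff_convolution\<close> carried over to all integers, with a common
  weight \<open>z\<close> that factors out. It has the form of the hypothesis \<open>inverse\<close>
  of \<open>correlation_orthogonality\<close>.\<close>

lemma euler_coeff_inv_q_fact:
  assumes p: "0 < p" "p < 1" and z: "z \<noteq> 0"
  shows "(\<Sum>\<^sub>\<infinity>i. (euler_coeff p i * z ^ i) * (z powi (t - int i) * inv_q_fact p (t - int i)))
    = (if t = 0 then 1 else 0)"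
proof (cases "t < 0")
  case True
  then show ?thesis by (simp add: inv_q_fact_def)
next
  case False
  define m where "m = nat t"
  have t: "t = int m" using False by (simp add: m_def)
  have "(\<Sum>\<^sub>\<infinity>i. (euler_coeff p i * z ^ i) * (z powi (t - int i) * inv_q_fact p (t - int i)))
      = (\<Sum>\<^sub>\<infinity>i\<in>{..m}. z ^ m * (euler_coeff p i / q_fact p (m - i)))"
  proof (rule infsum_cong_neutral)
    fix i assume "i \<in> UNIV \<inter> {..m}"
    then have i: "i \<le> m" by simp
    then have "t - int i = int (m - i)" by (simp add: t of_nat_diff)
    moreover have "z ^ m = z ^ i * z ^ (m - i)" using i by (simp add: power_add[symmetric])
    ultimately show "(euler_coeff p i * z ^ i) * (z powi (t - int i) * inv_q_fact p (t - int i))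
      = z ^ m * (euler_coeff p i / q_fact p (m - i))"
      by (simp add: inv_q_fact_def)
  qed (auto simp: t inv_q_fact_def)
  also have "\<dots> = z ^ m * (if m = 0 then 1 else 0)"
    by (simp only: infsum_finite[OF finite_atMost] sum_distrib_left[symmetric] euler_coeff_convolution[OF p])
  finally show ?thesis by (simp add: t)
qed

lemma bessel_seq_orthogonality_0:
  assumes p: "0 < p" "p < 1" and w: "0 < w" "w < 1"
  shows "(\<Sum>\<^sub>\<infinity>n. w powi n * (bessel_seq p w (n + l) * bessel_seq p w n)) = (if l = 0 then 1 else 0)"
proof -
  \<comment> \<open>The square root is the fixed point of z \<mapsto> w / z. With it both factors in
    \<open>bessel_seq_scaled\<close> carry the same base, as \<open>euler_coeff_inv_q_fact\<close>
    requires, and two weights \<open>r powi n\<close> make up \<open>w powi n\<close>.\<close>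
  define r where "r = sqrt w"
  have r: "0 < r" "r < 1" "r \<noteq> 0" "w / r = r"
    using w by (auto simp: r_def real_div_sqrt)
  have rr: "r powi n * r powi n = w powi n" for n
    using w by (simp add: r_def power_int_mult_distrib[symmetric])
  have "(\<Sum>\<^sub>\<infinity>n. (r powi (n + l) * bessel_seq p w (n + l)) * (r powi n * bessel_seq p w n))
      = (if l = 0 then 1 else 0)"
    unfolding bessel_seq_scaled[OF r(3)] r(4)
    by (rule correlation_orthogonality[OF abs_summable_euler[OF p]
          abs_summable_inv_q_fact[OF p r(1,2)] euler_coeff_inv_q_fact[OF p r(3)]])
  also have "(\<Sum>\<^sub>\<infinity>n. (r powi (n + l) * bessel_seq p w (n + l)) * (r powi n * bessel_seq p w n))
      = (\<Sum>\<^sub>\<infinity>n. r powi l * (w powi n * (bessel_seq p w (n + l) * bessel_seq p w n)))"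
    by (intro infsum_cong) (use r in \<open>simp add: power_int_add rr[symmetric] mult_ac\<close>)
  finally have "r powi l * (\<Sum>\<^sub>\<infinity>n. w powi n * (bessel_seq p w (n + l) * bessel_seq p w n))
      = (if l = 0 then 1 else 0)"
    by (simp only: infsum_cmult_right')
  then show ?thesis using r by (simp split: if_splits)
qed

lemma bessel_seq_orthogonality:
  assumes p: "0 < p" "p < 1" and w: "0 < w" "w < 1"
  shows "(\<Sum>\<^sub>\<infinity>k. w powi k * (bessel_seq p w (k + m) * bessel_seq p w (k + n)))
    = (if m = n then w powi (- n) else 0)"
proof -
  have "(\<Sum>\<^sub>\<infinity>k. w powi k * (bessel_seq p w (k + m) * bessel_seq p w (k + n)))
      = (\<Sum>\<^sub>\<infinity>k. w powi (k - n) * (bessel_seq p w (k + (m - n)) * bessel_seq p w k))"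
    using infsum_shift_int[of "\<lambda>k. w powi (k - n) * (bessel_seq p w (k + (m - n)) * bessel_seq p w k)" n]
    by (simp add: algebra_simps)
  also have "\<dots> = (\<Sum>\<^sub>\<infinity>k. w powi (- n) * (w powi k * (bessel_seq p w (k + (m - n)) * bessel_seq p w k)))"
    by (intro infsum_cong) (use w in \<open>simp add: power_int_diff power_int_minus divide_inverse mult_ac\<close>)
  also have "\<dots> = w powi (- n) * (if m - n = 0 then 1 else 0)"
    by (simp only: infsum_cmult_right' bessel_seq_orthogonality_0[OF assms])
  finally show ?thesis by simp
qed

text \<open>Expanding the infinite products by Euler's formula gives the same double series on both
  sides; its coupling factor \<open>p ^ (k * j)\<close> is symmetric.\<close>

lemma euler_sum_symmetric:
  assumes p: "0 < p" "p < 1"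
  shows "(\<Sum>\<^sub>\<infinity>k. euler_coeff p k * x ^ k * q_pochhammer_inf (y * p ^ k) p)
    = (\<Sum>\<^sub>\<infinity>j. euler_coeff p j * y ^ j * q_pochhammer_inf (x * p ^ j) p)"
proof -
  define f where "f = (\<lambda>k j. (euler_coeff p k * x ^ k) * (euler_coeff p j * y ^ j) * p ^ (k * j))"
  have "(\<lambda>(k, j). f k j) abs_summable_on UNIV \<times> UNIV"
  proof (rule Infinite_Sum.abs_summable_on_comparison_test[OF abs_summable_mult_pair])
    show "(\<lambda>k. euler_coeff p k * x ^ k) abs_summable_on UNIV"
      "(\<lambda>k. euler_coeff p k * y ^ k) abs_summable_on UNIV"
      by (intro abs_summable_euler p)+
    fix kj :: "nat \<times> nat"
    show "norm (case kj of (k, j) \<Rightarrow> f k j)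
        \<le> norm (case kj of (k, j) \<Rightarrow> euler_coeff p k * x ^ k * (euler_coeff p j * y ^ j))"
      using p by (simp only: f_def case_prod_unfold norm_mult) (simp add: mult_left_le power_le_one)
  qed
  then have "(\<Sum>\<^sub>\<infinity>k. \<Sum>\<^sub>\<infinity>j. f k j) = (\<Sum>\<^sub>\<infinity>j. \<Sum>\<^sub>\<infinity>k. f k j)"
    by (rule infsum_swap_banach[OF abs_summable_summable])
  moreover have "(\<Sum>\<^sub>\<infinity>j. f k j) = euler_coeff p k * x ^ k * q_pochhammer_inf (y * p ^ k) p" for k
    unfolding infsum_euler[OF p, symmetric] infsum_cmult_right'[symmetric] f_def
    by (intro infsum_cong) (simp add: power_mult_distrib power_mult)
  moreover have "(\<Sum>\<^sub>\<infinity>k. f k j) = euler_coeff p j * y ^ j * q_pochhammer_inf (x * p ^ j) p" for j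
    unfolding infsum_euler[OF p, symmetric] infsum_cmult_right'[symmetric] f_def
    by (intro infsum_cong) (simp add: power_mult_distrib power_mult[symmetric] mult_ac)
  ultimately show ?thesis by simp
qed

text \<open>The left-hand side is, up to a constant, the power series of the Bessel function.
  Exchanging the roles of \<open>p powi (n + 1)\<close> and \<open>w\<close> turns its infinite
  products into reciprocal q-factorials.\<close>

lemma bessel_seq_eq:
  assumes p: "0 < p" "p < 1"
  shows "(\<Sum>\<^sub>\<infinity>k. euler_coeff p k * (p powi (n + 1)) ^ k * q_pochhammer_inf (w * p ^ k) p)
    = q_pochhammer_inf p p * bessel_seq p w n"
proof -
  have "q_pochhammer_inf (p powi (n + 1) * p ^ j) p = q_pochhammer_inf p p * inv_q_fact p (n + int j)" for j
    using p q_pochhammer_inf_powi[OF p, of "n + int j"]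
    by (simp add: power_int_add mult_ac)
  then show ?thesis
    unfolding euler_sum_symmetric[OF p] bessel_seq_def infsum_cmult_right'[symmetric]
    by (simp add: mult_ac)
qed

text \<open>Needed to pass from \<open>infsum\<close> to \<open>sums\<close> in
  \<open>q_Bessel_eq\<close>. The infinite products lie between 0 and 1, so Euler's series
  dominates.\<close>

lemma abs_summable_bessel_series:
  assumes p: "0 < p" "p < 1" and y: "0 \<le> y" "y \<le> 1"
  shows "(\<lambda>k. euler_coeff p k * x ^ k * q_pochhammer_inf (y * p ^ k) p) abs_summable_on UNIV"
proof (rule Infinite_Sum.abs_summable_on_comparison_test[OF abs_summable_euler[OF p, of x]])
  fix k
  have y1: "y * p ^ k \<le> 1" "0 \<le> y * p ^ k"
    using p y by (auto simp: mult_le_one power_le_one)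
  have "0 \<le> q_pochhammer_inf (y * p ^ k) p"
  proof (cases "y * p ^ k < 1")
    case True
    then show ?thesis using q_pochhammer_inf_pos[OF p] by (simp add: less_imp_le)
  next
    \<comment> \<open>Here \<open>y * p ^ k\<close> equals 1, and the first factor of the infinite
      product vanishes.\<close>
    case False
    then show ?thesis
      using y1 q_pochhammer_inf_split[OF p, of "y * p ^ k" 1] by simp
  qed
  moreover have "q_pochhammer_inf (y * p ^ k) p \<le> 1"
    by (rule q_pochhammer_inf_le_1[OF p y1(2,1)])
  ultimately show "norm (euler_coeff p k * x ^ k * q_pochhammer_inf (y * p ^ k) p)
      \<le> norm (euler_coeff p k * x ^ k)"
    by (simp only: norm_mult) (simp add: mult_left_le)
qed

section \<open>Inverting a transform with kernel a(n + k) by its orthogonality relation\<close>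

lemma abs_summable_mult_bounded:
  fixes u v :: "'a \<Rightarrow> 'b::real_normed_algebra"
  assumes u: "u abs_summable_on UNIV" and v: "\<And>x. norm (v x) \<le> B"
  shows "(\<lambda>x. u x * v x) abs_summable_on UNIV"
proof (rule Infinite_Sum.abs_summable_on_comparison_test)
  show "(\<lambda>x. B *\<^sub>R u x) abs_summable_on UNIV"
    using u by (simp add: summable_on_cmult_right)
  fix x
  have "norm (u x * v x) \<le> norm (u x) * norm (v x)" by (rule norm_mult_ineq)
  also have "\<dots> \<le> norm (u x) * \<bar>B\<bar>" using v[of x] by (intro mult_left_mono) auto
  finally show "norm (u x * v x) \<le> norm (B *\<^sub>R u x)" by (simp add: mult.commute)
qed

lemma infsum_of_real_complex:
  assumes "u summable_on (A :: 'a set)"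
  shows "(\<Sum>\<^sub>\<infinity>x\<in>A. complex_of_real (u x)) = of_real (infsum u A)"
  using has_sum_of_real[OF has_sum_infsum[OF assms]] by (rule infsumI)

text \<open>The kernel depends on \<open>n + k\<close> only, hence is symmetric, and the transform
  is its own inverse up to \<open>c\<close>. \<open>Wa\<close> gives summability in
  \<open>k\<close>, \<open>Wg\<close> in \<open>n\<close>, and the coupling factor is bounded, so
  the sums may be exchanged; then \<open>orth\<close> leaves the single term
  \<open>n = l\<close>.\<close>

lemma correlation_inversion:
  fixes a W :: "int \<Rightarrow> real" and g :: "int \<Rightarrow> complex"
  assumes a: "\<And>n. \<bar>a n\<bar> \<le> B"
    and W: "\<And>n. W n \<noteq> 0"
    and Wa: "\<And>l. (\<lambda>k. W k * a (k + l)) abs_summable_on UNIV"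
    and Wg: "(\<lambda>n. of_real (W n) * g n) abs_summable_on UNIV"
    and orth: "\<And>m n. c * (\<Sum>\<^sub>\<infinity>k. W k * (a (k + m) * a (k + n))) = (if m = n then 1 / W n else 0)"
  shows "of_real c * (\<Sum>\<^sub>\<infinity>k. of_real (W k * a (k + l)) * (\<Sum>\<^sub>\<infinity>n. of_real (W n * a (n + k)) * g n)) = g l"
proof -
  define F where "F = (\<lambda>k n. (of_real (W k * a (k + l)) * (of_real (W n) * g n)) * complex_of_real (a (n + k)))"
  have "(\<lambda>k. complex_of_real (W k * a (k + l))) abs_summable_on UNIV"
    using Wa[of l] by (simp only: norm_of_real) simp
  from abs_summable_mult_bounded[OF abs_summable_mult_pair[OF this Wg, simplified],
      where B = B and v = "\<lambda>(k, n). of_real (a (n + k))"]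
  have sm: "(\<lambda>(k, n). F k n) abs_summable_on UNIV \<times> UNIV"
    using a by (simp add: F_def case_prod_unfold)
  have "(\<Sum>\<^sub>\<infinity>k. of_real (W k * a (k + l)) * (\<Sum>\<^sub>\<infinity>n. of_real (W n * a (n + k)) * g n))
      = (\<Sum>\<^sub>\<infinity>k. \<Sum>\<^sub>\<infinity>n. F k n)"
    unfolding infsum_cmult_right'[symmetric] F_def by (intro infsum_cong) (simp add: mult_ac)
  also have "\<dots> = (\<Sum>\<^sub>\<infinity>n. \<Sum>\<^sub>\<infinity>k. F k n)"
    by (rule infsum_swap_banach[OF abs_summable_summable[OF sm]])
  also have "\<dots> = (\<Sum>\<^sub>\<infinity>n. (of_real (W n) * g n) * of_real (\<Sum>\<^sub>\<infinity>k. W k * (a (k + l) * a (k + n))))"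
  proof (rule infsum_cong)
    fix n
    have "(\<lambda>k. W k * a (k + l) * a (k + n)) summable_on UNIV"
      by (rule abs_summable_summable[OF abs_summable_mult_bounded[OF Wa, where B = B]]) (use a in simp)
    then have "of_real (\<Sum>\<^sub>\<infinity>k. W k * (a (k + l) * a (k + n)))
        = (\<Sum>\<^sub>\<infinity>k. complex_of_real (W k * (a (k + l) * a (k + n))))"
      by (subst infsum_of_real_complex) (simp_all add: mult.assoc)
    then show "(\<Sum>\<^sub>\<infinity>k. F k n) = (of_real (W n) * g n) * of_real (\<Sum>\<^sub>\<infinity>k. W k * (a (k + l) * a (k + n)))"
      unfolding F_def by (simp only: infsum_cmult_right'[symmetric]) (intro infsum_cong, simp add: mult_ac add_ac)
  qed
  finally have eq: "(\<Sum>\<^sub>\<infinity>k. of_real (W k * a (k + l)) * (\<Sum>\<^sub>\<infinity>n. of_real (W n * a (n + k)) * g n))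
      = (\<Sum>\<^sub>\<infinity>n. (of_real (W n) * g n) * of_real (\<Sum>\<^sub>\<infinity>k. W k * (a (k + l) * a (k + n))))" .
  have "of_real c * (\<Sum>\<^sub>\<infinity>k. of_real (W k * a (k + l)) * (\<Sum>\<^sub>\<infinity>n. of_real (W n * a (n + k)) * g n))
      = (\<Sum>\<^sub>\<infinity>n. (of_real (W n) * g n) * of_real (c * (\<Sum>\<^sub>\<infinity>k. W k * (a (k + l) * a (k + n)))))"
    unfolding eq by (subst infsum_cmult_right'[symmetric]) (intro infsum_cong, simp add: mult_ac)
  also have "\<dots> = (\<Sum>\<^sub>\<infinity>n\<in>{l}. g n)"
    unfolding orth using W by (intro infsum_cong_neutral) auto
  finally show ?thesis by simp
qed

subsection \<open>The q-Dunkl kernel on the lattice\<close>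

lemma q_number_eq:
  assumes "0 < q"
  shows "q_number q (2 * \<alpha> + 2) = (1 - (q\<^sup>2) powr (\<alpha> + 1)) / (1 - q)"
proof -
  have "(q\<^sup>2) powr (\<alpha> + 1) = (q powr 2) powr (\<alpha> + 1)"
    using assms by (simp add: powr_numeral)
  also have "\<dots> = q powr (2 * \<alpha> + 2)" by (simp add: powr_powr algebra_simps)
  finally show ?thesis by (simp add: q_number_def)
qed

lemma c_const_eq:
  assumes q: "0 < q" "q < 1"
  shows "c_const \<alpha> q = (1 - q) powr \<alpha> * q_pochhammer_inf ((q\<^sup>2) powr (\<alpha> + 1)) (q\<^sup>2)
    / q_pochhammer_inf (q\<^sup>2) (q\<^sup>2)"
proof -
  have "1 - q\<^sup>2 = (1 + q) * (1 - q)" by (simp add: power2_eq_square algebra_simps)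
  then have "(1 - q\<^sup>2) powr (1 - (\<alpha> + 1)) = (1 + q) powr (- \<alpha>) * (1 - q) powr (- \<alpha>)"
    using q by (simp add: powr_mult)
  then show ?thesis
    using q by (simp add: c_const_def q_Gamma_def powr_minus field_simps)
qed

text \<open>The series is compared term by term with the one in \<open>bessel_seq_eq\<close>. The
  condition on \<open>y\<close> places the argument on the lattice: its rescaled square is an
  integral power of the base.\<close>

lemma q_Bessel_eq:
  assumes q: "0 < q" "q < 1" and \<alpha>: "- 1 < \<alpha>"
    and y: "((1 - q) * y)\<^sup>2 = (q\<^sup>2) powi n"
  shows "q_Bessel \<alpha> q y = q_pochhammer_inf (q\<^sup>2) (q\<^sup>2)
    / q_pochhammer_inf ((q\<^sup>2) powr (\<alpha> + 1)) (q\<^sup>2) * bessel_seq (q\<^sup>2) ((q\<^sup>2) powr (\<alpha> + 1)) n"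
proof -
  define p where "p = q\<^sup>2"
  define w where "w = p powr (\<alpha> + 1)"
  have p: "0 < p" "p < 1" using q by (auto simp: p_def power_less_one_iff)
  have w: "0 < w" "w < 1" using p \<alpha> by (auto simp: w_def powr01_less_one)
  define P where "P = q_pochhammer_inf p p"
  define V where "V = q_pochhammer_inf w p"
  have P: "0 < P" unfolding P_def by (rule q_pochhammer_inf_pos[OF p p(2)])
  have V: "0 < V" unfolding V_def by (rule q_pochhammer_inf_pos[OF p w(2)])
  let ?T = "\<lambda>k. euler_coeff p k * (p powi (n + 1)) ^ k * q_pochhammer_inf (w * p ^ k) p"
  have "(?T has_sum (\<Sum>\<^sub>\<infinity>k. ?T k)) UNIV"
    by (rule has_sum_infsum[OF abs_summable_summable[OF abs_summable_bessel_series[OF p]]])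
      (use w in auto)
  then have sums: "(\<lambda>k. 1 / V * ?T k) sums (1 / V * (P * bessel_seq p w n))"
    unfolding bessel_seq_eq[OF p] P_def by (intro sums_mult has_sum_imp_sums)
  have "(-1) ^ k * (q_Gamma (q\<^sup>2) (\<alpha> + 1) * q ^ (k * (k + 1)))
            / (q_Gamma (q\<^sup>2) (\<alpha> + real k + 1) * q_Gamma (q\<^sup>2) (real k + 1))
            * (y / (1 + q)) ^ (2 * k) = 1 / V * ?T k" for k
  proof -
    define V' where "V' = q_pochhammer_inf (w * p ^ k) p"
    define F where "F = q_fact p k"
    have "w * p ^ k \<le> w * 1"
      using w p by (intro mult_left_mono) (auto simp: power_le_one)
    then have "w * p ^ k < 1"
      by (rule le_less_trans) (use w in simp)
    then have V': "0 < V'" unfolding V'_def by (rule q_pochhammer_inf_pos[OF p])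
    have F: "0 < F" unfolding F_def by (rule q_fact_pos[OF p])
    have "p powr (\<alpha> + real k + 1) = w * p ^ k"
      using p by (simp add: w_def powr_add powr_realpow mult_ac)
    then have G1: "q_Gamma p (\<alpha> + real k + 1) = P / V' * ((1 - p) powr (- \<alpha>) / (1 - p) ^ k)"
      using p by (simp add: q_Gamma_def P_def V'_def powr_diff powr_realpow powr_minus field_simps)
    have G0: "q_Gamma p (\<alpha> + 1) = P / V * (1 - p) powr (- \<alpha>)"
      by (simp add: q_Gamma_def P_def V_def w_def)
    have "p powr (real k + 1) = p ^ Suc k"
      using p powr_realpow[of p "Suc k"] by (simp add: add.commute)
    then have "q_Gamma p (real k + 1) = P / q_pochhammer_inf (p ^ Suc k) p * (1 - p) powr (- real k)"
      by (simp add: q_Gamma_def P_def)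
    moreover have "q_pochhammer_inf (p ^ Suc k) p = P / F"
      using q_fact_eq[OF p, of k] F by (simp add: P_def F_def field_simps)
    moreover have "(1 - p) powr (- real k) = 1 / (1 - p) ^ k"
      using p by (simp add: powr_minus powr_realpow inverse_eq_divide)
    ultimately have G2: "q_Gamma p (real k + 1) = F / (1 - p) ^ k"
      using P F by (simp del: power_Suc)
    \<comment> \<open>The two powers of \<open>1 - p\<close> come from the two Gamma factors in the
      denominator; they turn \<open>y / (1 + q)\<close> into \<open>(1 - q) * y\<close>.\<close>
    have "(y / (1 + q)) ^ (2 * k) * ((1 - p) ^ k * (1 - p) ^ k) = ((y / (1 + q) * (1 - p))\<^sup>2) ^ k"
      by (simp only: power_mult power_mult_distrib) (simp add: power_mult_distrib[symmetric] power2_eq_square)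
    also have "y / (1 + q) * (1 - p) = (1 - q) * y"
      using q by (simp add: p_def power2_eq_square field_simps)
    finally have Y: "(y / (1 + q)) ^ (2 * k) * ((1 - p) ^ k * (1 - p) ^ k) = (p powi n) ^ k"
      by (simp only: y p_def)
    \<comment> \<open>The binomial part belongs to \<open>euler_coeff\<close>; the remaining
      \<open>p ^ k\<close> accounts for the exponent \<open>n + 1\<close> in place of
      \<open>n\<close>.\<close>
    have "k * (k + 1) = 2 * ((k choose 2) + k)"
      by (induction k) (auto simp: Suc_choose_2 numeral_2_eq_2)
    then have Q: "q ^ (k * (k + 1)) = p ^ (k choose 2) * p ^ k"
      by (simp add: p_def power_mult power_add power_mult_distrib)
    have "(p powi (n + 1)) ^ k = (p powi n) ^ k * p ^ k"
      using p by (simp add: power_int_add power_mult_distrib)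
    then have "?T k = (-1) ^ k * p ^ (k choose 2) * p ^ k / F * ((p powi n) ^ k) * V'"
      by (simp add: euler_coeff_def F_def V'_def mult_ac)
    then show ?thesis
      unfolding p_def[symmetric] G0 G1 G2 Q Y[symmetric]
      using p P V V' F by (simp add: field_simps)
  qed
  then have "(\<lambda>k. 1 / V * ?T k) = (\<lambda>k. (-1) ^ k * (q_Gamma (q\<^sup>2) (\<alpha> + 1) * q ^ (k * (k + 1)))
            / (q_Gamma (q\<^sup>2) (\<alpha> + real k + 1) * q_Gamma (q\<^sup>2) (real k + 1))
            * (y / (1 + q)) ^ (2 * k))" by simp
  with sums have "q_Bessel \<alpha> q y = 1 / V * (P * bessel_seq p w n)"
    unfolding q_Bessel_def by (simp only: sums_iff)
  then show ?thesis by (simp add: P_def V_def w_def p_def)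
qed

lemma q_Dunkl_kernel_commute: "q_Dunkl_kernel \<alpha> q \<xi> x = q_Dunkl_kernel \<alpha> q x \<xi>"
  by (simp add: q_Dunkl_kernel_def mult.commute)

lemma q_Bessel_minus: "q_Bessel \<alpha> q (- x) = q_Bessel \<alpha> q x"
  unfolding q_Bessel_def by (simp add: power_mult)

lemma cnj_q_Dunkl_kernel: "cnj (q_Dunkl_kernel \<alpha> q \<xi> x) = q_Dunkl_kernel \<alpha> q (- \<xi>) x"
  by (simp add: q_Dunkl_kernel_def q_Bessel_minus)

text \<open>The integer \<open>m\<close> is the offset between the lattice point
  \<open>q powi k\<close> and the index \<open>k + m\<close> at which \<open>bessel_seq\<close> is
  evaluated, see \<open>lattice_sq\<close>.\<close>

locale q_Dunkl_lattice =
  fixes q \<alpha> :: real and m :: int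
  assumes q: "0 < q" "q < 1" and \<alpha>: "- 1 < \<alpha>" and lattice: "1 - q = q powi m"
begin

abbreviation "p \<equiv> q\<^sup>2"

definition w :: real where "w = p powr (\<alpha> + 1)"

text \<open>Together with \<open>odd_seq\<close> this gives the real part and, up to sign, the
  imaginary part of the normalised kernel when its arguments multiply to plus or minus
  \<open>q powi k\<close>, see \<open>q_Dunkl_kernel_lattice\<close>.\<close>

definition even_seq :: "int \<Rightarrow> real" where
  "even_seq k = c_const \<alpha> q * q_Bessel \<alpha> q (q powi k)"

definition odd_seq :: "int \<Rightarrow> real" where
  "odd_seq k = c_const \<alpha> q * (q powi k / q_number q (2 * \<alpha> + 2) * q_Bessel (\<alpha> + 1) q (q powi k))"

lemma p: "0 < p" "p < 1"
  using q by (auto simp: power_less_one_iff)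

lemma w: "0 < w" "w < 1" "0 < w * p" "w * p < 1" "0 < w * q" "w * q < 1"
proof -
  show "0 < w" "w < 1" using p \<alpha> by (auto simp: w_def powr01_less_one)
  then show "0 < w * p" "w * p < 1" "0 < w * q" "w * q < 1"
    using p q mult_strict_mono[of w 1 p 1] mult_strict_mono[of w 1 q 1] by auto
qed

lemma w_Suc: "p powr (\<alpha> + 1 + 1) = w * p"
  using p by (simp add: w_def powr_add)

lemma powi_powr:
  assumes "0 < (x :: real)"
  shows "(x powi n) powr s = (x powr s) powi n"
proof -
  have "(x powi n) powr s = (x powr of_int n) powr s"
    using assms by (simp add: powr_real_of_int')
  also have "\<dots> = (x powr s) powr of_int n"
    by (simp add: powr_powr mult.commute)
  finally show ?thesis using assms by (simp add: powr_real_of_int')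
qed

lemma w_eq: "w = q powr (2 * \<alpha> + 2)"
proof -
  have "w = (q powr 2) powr (\<alpha> + 1)"
    using q by (simp add: w_def powr_numeral)
  also have "\<dots> = q powr (2 * \<alpha> + 2)" by (simp add: powr_powr algebra_simps)
  finally show ?thesis .
qed

text \<open>Up to the factor \<open>1 - q\<close>, this is the mass of the weighted Jackson measure
  at each of the points plus and minus \<open>q powi n\<close>.\<close>

lemma weight: "q powi n * (q powi n) powr (2 * \<alpha> + 1) = w powi n"
proof -
  have "q powi n * (q powi n) powr (2 * \<alpha> + 1) = (q powi n) powr (2 * \<alpha> + 2)"
    using q by (subst powr_mult_base) (auto simp: add_ac)
  then show ?thesis by (simp only: powi_powr[OF q(1)] w_eq)
qed

lemma lattice_weight: "(1 - q) powr (2 * \<alpha> + 2) = w powi m"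
  by (simp only: lattice powi_powr[OF q(1)] w_eq)

lemma lattice_sq: "((1 - q) * q powi k)\<^sup>2 = p powi (k + m)"
proof -
  have "((1 - q) * q powi k)\<^sup>2 = (q powi (k + m))\<^sup>2"
    using q by (simp add: lattice power_int_add mult.commute)
  then show ?thesis by (simp add: power_int_power' power_int_power mult.commute)
qed

lemma c_const_pos: "0 < c_const \<alpha> q"
  unfolding c_const_eq[OF q]
  using q_pochhammer_inf_pos[OF p p(2)] q_pochhammer_inf_pos[OF p w(2)] q
  by (auto simp: w_def intro!: divide_pos_pos mult_pos_pos)

lemma even_seq_eq: "even_seq k = (1 - q) powr \<alpha> * bessel_seq p w (k + m)"
proof -
  have "0 < q_pochhammer_inf w p" "0 < q_pochhammer_inf p p"
    using q_pochhammer_inf_pos[OF p] w p by auto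
  then show ?thesis
    unfolding even_seq_def c_const_eq[OF q] q_Bessel_eq[OF q \<alpha> lattice_sq[of k]] w_def[symmetric]
    by simp
qed

text \<open>The infinite products for \<open>w\<close> and \<open>w * p\<close> differ by the factor
  \<open>1 - w\<close>, which cancels against the q-number and leaves a factor \<open>1 - q\<close>.
  So the odd part is the Bessel sequence for \<alpha> + 1, with an additional
  \<open>q powi k\<close>.\<close>

lemma odd_seq_eq: "odd_seq k = (1 - q) powr (\<alpha> + 1) * (q powi k * bessel_seq p (w * p) (k + m))"
proof -
  have pos: "0 < q_pochhammer_inf (w * p) p" "0 < q_pochhammer_inf p p"
    using q_pochhammer_inf_pos[OF p] w p by auto
  have split: "q_pochhammer_inf w p = (1 - w) * q_pochhammer_inf (w * p) p"
    using q_pochhammer_inf_split[OF p, of w 1] by simp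
  have "- 1 < \<alpha> + 1" using \<alpha> by simp
  then have "odd_seq k = ((1 - q) powr \<alpha> * (1 - q)) * (q powi k * bessel_seq p (w * p) (k + m))"
    unfolding odd_seq_def c_const_eq[OF q] q_Bessel_eq[OF q \<open>- 1 < \<alpha> + 1\<close> lattice_sq[of k]]
      q_number_eq[OF q(1)] w_Suc w_def[symmetric] split
    using pos w(2) q by (simp add: field_simps)
  then show ?thesis using q by (simp add: powr_add)
qed

lemma even_seq_bounded: obtains B where "\<And>k. \<bar>even_seq k\<bar> \<le> B"
proof -
  obtain B where "\<And>k. \<bar>bessel_seq p w k\<bar> \<le> B"
    using bessel_seq_bounded[OF p] by blast
  then have "\<bar>even_seq k\<bar> \<le> (1 - q) powr \<alpha> * B" for k
    unfolding even_seq_eq by (simp add: abs_mult mult_left_mono)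
  then show thesis by (rule that)
qed

lemma odd_seq_bounded: obtains B where "\<And>k. \<bar>odd_seq k\<bar> \<le> B"
proof -
  \<comment> \<open>The factor \<open>q powi k\<close> is unbounded towards minus infinity, so
    boundedness of \<open>bessel_seq\<close> does not suffice; summability with weight
    \<open>q\<close> bounds the product.\<close>
  obtain B where B: "\<And>k. \<bar>q powi k * bessel_seq p (w * p) k\<bar> \<le> B"
    using abs_summable_bounded[OF abs_summable_bessel_seq[OF p q]] by blast
  have "\<bar>odd_seq k\<bar> \<le> (1 - q) powr (\<alpha> + 1) * (q powi (- m) * B)" for k
  proof -
    have "q powi k * bessel_seq p (w * p) (k + m)
        = q powi (- m) * (q powi (k + m) * bessel_seq p (w * p) (k + m))"
      using q by (simp add: power_int_add power_int_minus)
    then have "\<bar>q powi k * bessel_seq p (w * p) (k + m)\<bar> \<le> q powi (- m) * B"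
      using B[of "k + m"] q by (simp only: abs_mult) (intro mult_mono, auto)
    then show ?thesis
      unfolding odd_seq_eq by (simp add: abs_mult mult_left_mono)
  qed
  then show thesis by (rule that)
qed

lemma even_seq_summable: "(\<lambda>k. w powi k * even_seq (k + l)) abs_summable_on UNIV"
proof -
  have "(\<lambda>k. norm (w powi (k + (l + m)) * bessel_seq p w (k + (l + m)))) summable_on UNIV"
    using abs_summable_bessel_seq[OF p w(1,2)]
      summable_on_shift_int[of "\<lambda>k. norm (w powi k * bessel_seq p w k)" "l + m"] by blast
  from summable_on_cmult_right[OF this, of "(1 - q) powr \<alpha> * w powi (- l - m)"]
  show ?thesis
    using w(1) by (simp add: even_seq_eq abs_mult power_int_add power_int_diff power_int_minus field_simps)
qed

lemma odd_seq_summable: "(\<lambda>k. w powi k * odd_seq (k + l)) abs_summable_on UNIV"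
proof -
  have "(\<lambda>k. norm ((w * q) powi (k + (l + m)) * bessel_seq p (w * p) (k + (l + m)))) summable_on UNIV"
    using abs_summable_bessel_seq[OF p w(5,6)]
      summable_on_shift_int[of "\<lambda>k. norm ((w * q) powi k * bessel_seq p (w * p) k)" "l + m"] by blast
  from summable_on_cmult_right[OF this, of "(1 - q) powr (\<alpha> + 1) * w powi (- l - m) * q powi (- m)"]
  show ?thesis
    using w(1) q by (simp add: odd_seq_eq abs_mult power_int_add power_int_diff power_int_minus
        power_int_mult_distrib field_simps)
qed

text \<open>The factor \<open>(1 - q)\<^sup>2\<close> stems from the two Jackson integrals. With the
  two factors \<open>(1 - q) powr \<alpha>\<close> it combines to \<open>w powi m\<close>, which
  offsets the shift of the indices by \<open>m\<close>.\<close>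

lemma even_seq_orthogonality:
  "(1 - q)\<^sup>2 * (\<Sum>\<^sub>\<infinity>k. w powi k * (even_seq (k + i) * even_seq (k + n))) = (if i = n then 1 / w powi n else 0)"
proof -
  have "(\<Sum>\<^sub>\<infinity>k. w powi k * (even_seq (k + i) * even_seq (k + n)))
      = ((1 - q) powr \<alpha>)\<^sup>2 * (\<Sum>\<^sub>\<infinity>k. w powi k * (bessel_seq p w (k + (i + m)) * bessel_seq p w (k + (n + m))))"
    unfolding infsum_cmult_right'[symmetric] even_seq_eq
    by (intro infsum_cong) (simp add: power2_eq_square mult_ac add_ac)
  moreover have "(1 - q)\<^sup>2 * ((1 - q) powr \<alpha>)\<^sup>2 = w powi m"
    using q by (simp add: lattice_weight[symmetric] powr_add powr_numeral power2_eq_square mult.commute[of 2]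
       powr_mult_base) (simp add: powr_add[symmetric] mult_ac)
  ultimately have "(1 - q)\<^sup>2 * (\<Sum>\<^sub>\<infinity>k. w powi k * (even_seq (k + i) * even_seq (k + n)))
      = w powi m * (if i = n then w powi (- (n + m)) else 0)"
    unfolding bessel_seq_orthogonality[OF p w(1,2)] by (simp add: mult.assoc[symmetric])
  then show ?thesis
    using w(1) by (simp add: power_int_diff power_int_minus power_int_add field_simps)
qed

text \<open>The two powers of \<open>q\<close> in \<open>odd_seq\<close> change the weight from
  \<open>w\<close> to \<open>w * p\<close>, the one belonging to \<alpha> + 1. What they leave at
  \<open>i = n\<close>, namely \<open>p powi n\<close>, restores the right-hand side of the even
  case.\<close>

lemma odd_seq_orthogonality:
  "(1 - q)\<^sup>2 * (\<Sum>\<^sub>\<infinity>k. w powi k * (odd_seq (k + i) * odd_seq (k + n))) = (if i = n then 1 / w powi n else 0)"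
proof -
  have pk: "q powi k * q powi k = p powi k" for k
    by (simp add: power2_eq_square power_int_mult_distrib)
  have "(\<Sum>\<^sub>\<infinity>k. w powi k * (odd_seq (k + i) * odd_seq (k + n)))
      = ((1 - q) powr (\<alpha> + 1))\<^sup>2 * q powi i * q powi n *
        (\<Sum>\<^sub>\<infinity>k. (w * p) powi k * (bessel_seq p (w * p) (k + (i + m)) * bessel_seq p (w * p) (k + (n + m))))"
    unfolding infsum_cmult_right'[symmetric] odd_seq_eq
    by (intro infsum_cong)
      (use q in \<open>simp add: power2_eq_square mult_ac add_ac power_int_add power_int_mult_distrib\<close>)
  moreover have "(1 - q)\<^sup>2 * ((1 - q) powr (\<alpha> + 1))\<^sup>2 = (w * p) powi m"
  proof -
    have "((1 - q) powr (\<alpha> + 1))\<^sup>2 = w powi m"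
      using q by (simp add: lattice_weight[symmetric] power2_eq_square powr_add[symmetric])
    moreover have "(1 - q)\<^sup>2 = p powi m"
      using pk[of m] by (simp only: lattice power2_eq_square)
    ultimately show ?thesis by (simp add: power_int_mult_distrib)
  qed
  ultimately have "(1 - q)\<^sup>2 * (\<Sum>\<^sub>\<infinity>k. w powi k * (odd_seq (k + i) * odd_seq (k + n)))
      = (w * p) powi m * q powi i * q powi n * (if i = n then (w * p) powi (- (n + m)) else 0)"
    unfolding bessel_seq_orthogonality[OF p w(3,4)] by (simp add: mult.assoc[symmetric])
  also have "\<dots> = (w * p) powi m * (if i = n then p powi n * (w * p) powi (- (n + m)) else 0)"
    by (simp add: pk[symmetric])
  also have "\<dots> = (if i = n then 1 / w powi n else 0)"
    using w(1) q by (simp add: power_int_diff power_int_minus power_int_add power_int_mult_distrib field_simps)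
  finally show ?thesis .
qed

lemma q_Dunkl_kernel_lattice:
  assumes \<sigma>: "\<sigma> = 1 \<or> \<sigma> = - 1" and "\<xi> * x = \<sigma> * q powi k"
  shows "of_real (c_const \<alpha> q) * q_Dunkl_kernel \<alpha> q \<xi> x
    = of_real (even_seq k) + \<i> * of_real \<sigma> * of_real (odd_seq k)"
proof -
  have "q_Bessel \<beta> q (\<sigma> * q powi k) = q_Bessel \<beta> q (q powi k)" for \<beta>
    using \<sigma> by (auto simp: q_Bessel_minus)
  then show ?thesis
    unfolding q_Dunkl_kernel_def even_seq_def odd_seq_def assms(2)
    by (simp add: algebra_simps)
qed

text \<open>Serves the transform and its inverse alike, with opposite signs \<tau>. Adding the
  contributions of a lattice point and its negative pairs \<open>even_seq\<close> with the even part
  of \<open>g\<close> and \<open>odd_seq\<close> with the odd part.\<close>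

lemma jackson_integral_q_Dunkl:
  fixes g :: "real \<Rightarrow> complex"
  defines "G \<equiv> \<lambda>n. norm (g (q powi n)) + norm (g (- (q powi n)))"
    and "h \<equiv> \<lambda>\<zeta> x. g x * q_Dunkl_kernel \<alpha> q \<zeta> x * of_real (\<bar>x\<bar> powr (2 * \<alpha> + 1))"
  assumes \<tau>: "\<tau> = 1 \<or> \<tau> = - 1" and \<zeta>: "\<zeta> = \<tau> * q powi k"
    and even: "(\<lambda>n. w powi n * even_seq (n + k) * G n) abs_summable_on UNIV"
    and odd: "(\<lambda>n. w powi n * odd_seq (n + k) * G n) abs_summable_on UNIV"
  shows "jackson_integrable q (h \<zeta>)"
    and "of_real (c_const \<alpha> q / 2) * jackson_integral q (h \<zeta>) = of_real ((1 - q) / 2) *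
      ((\<Sum>\<^sub>\<infinity>n. of_real (w powi n * even_seq (n + k)) * (g (q powi n) + g (- (q powi n))))
        + \<i> * of_real \<tau> *
          (\<Sum>\<^sub>\<infinity>n. of_real (w powi n * odd_seq (n + k)) * (g (q powi n) - g (- (q powi n)))))"
proof -
  let ?c = "c_const \<alpha> q"
  have summand: "of_real (?c * q powi n) * h \<zeta> (s * q powi n)
      = of_real (w powi n) * g (s * q powi n)
        * (of_real (even_seq (n + k)) + \<i> * of_real (\<tau> * s) * of_real (odd_seq (n + k)))"
    if s: "s = 1 \<or> s = - 1" for n s
  proof -
    have "\<zeta> * (s * q powi n) = (\<tau> * s) * q powi (n + k)"
      using q by (simp add: \<zeta> power_int_add)
    moreover have "\<tau> * s = 1 \<or> \<tau> * s = - 1" using \<tau> s by auto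
    ultimately have K: "of_real ?c * q_Dunkl_kernel \<alpha> q \<zeta> (s * q powi n)
        = of_real (even_seq (n + k)) + \<i> * of_real (\<tau> * s) * of_real (odd_seq (n + k))"
      by (intro q_Dunkl_kernel_lattice)
    have "\<bar>s * q powi n\<bar> = q powi n" using s q by auto
    then have "of_real (?c * q powi n) * h \<zeta> (s * q powi n)
      = of_real (q powi n * (q powi n) powr (2 * \<alpha> + 1)) * g (s * q powi n)
        * (of_real ?c * q_Dunkl_kernel \<alpha> q \<zeta> (s * q powi n))"
      by (simp add: h_def mult_ac)
    then show ?thesis by (simp only: weight K)
  qed
  have norm_term: "?c * (q powi n * norm (h \<zeta> (s * q powi n)))
      \<le> w powi n * norm (g (s * q powi n)) * (\<bar>even_seq (n + k)\<bar> + \<bar>odd_seq (n + k)\<bar>)"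
    if s: "s = 1 \<or> s = - 1" for n s
  proof -
    have "?c * (q powi n * norm (h \<zeta> (s * q powi n))) = norm (of_real (?c * q powi n) * h \<zeta> (s * q powi n))"
      using c_const_pos q by (simp only: norm_mult norm_of_real) (simp add: abs_mult)
    also have "\<dots> = w powi n * norm (g (s * q powi n))
        * norm (of_real (even_seq (n + k)) + \<i> * of_real (\<tau> * s) * complex_of_real (odd_seq (n + k)))"
      unfolding summand[OF s] norm_mult[of "of_real (w powi n) * g (s * q powi n)"]
        norm_mult[of "of_real (w powi n)"] norm_of_real using w(1) by simp
    also have "\<dots> \<le> w powi n * norm (g (s * q powi n)) * (\<bar>even_seq (n + k)\<bar> + \<bar>odd_seq (n + k)\<bar>)"
    proof (rule mult_left_mono)
      have "\<bar>\<tau> * s\<bar> = 1" using \<tau> s by auto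
      then have "norm (\<i> * of_real (\<tau> * s) * complex_of_real (odd_seq (n + k))) = \<bar>odd_seq (n + k)\<bar>"
        by (simp only: norm_mult norm_of_real norm_ii mult_1)
      then show "norm (of_real (even_seq (n + k)) + \<i> * of_real (\<tau> * s) * complex_of_real (odd_seq (n + k)))
          \<le> \<bar>even_seq (n + k)\<bar> + \<bar>odd_seq (n + k)\<bar>"
        by (intro order.trans[OF norm_triangle_ineq]) simp
    qed (use w(1) in simp)
    finally show ?thesis .
  qed
  show "jackson_integrable q (h \<zeta>)"
    unfolding jackson_integrable_def
  proof (rule summable_on_comparison_test)
    show "(\<lambda>n. 1 / ?c * (norm (w powi n * even_seq (n + k) * G n) + norm (w powi n * odd_seq (n + k) * G n)))
        summable_on UNIV"
      by (intro summable_on_cmult_right summable_on_add even odd)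
    fix n
    have G: "\<bar>G n\<bar> = G n" by (simp add: G_def)
    have "?c * (q powi n * (norm (h \<zeta> (q powi n)) + norm (h \<zeta> (- (q powi n)))))
        \<le> w powi n * norm (g (q powi n)) * (\<bar>even_seq (n + k)\<bar> + \<bar>odd_seq (n + k)\<bar>)
          + w powi n * norm (g (- (q powi n))) * (\<bar>even_seq (n + k)\<bar> + \<bar>odd_seq (n + k)\<bar>)"
      using norm_term[of 1 n] norm_term[of "- 1" n] by (simp add: distrib_left)
    also have "\<dots> = w powi n * G n * (\<bar>even_seq (n + k)\<bar> + \<bar>odd_seq (n + k)\<bar>)"
      by (simp add: G_def algebra_simps)
    also have "\<dots> = norm (w powi n * even_seq (n + k) * G n) + norm (w powi n * odd_seq (n + k) * G n)"
      using w(1) by (simp add: abs_mult G algebra_simps)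
    finally show "q powi n * (norm (h \<zeta> (q powi n)) + norm (h \<zeta> (- (q powi n))))
        \<le> 1 / ?c * (norm (w powi n * even_seq (n + k) * G n) + norm (w powi n * odd_seq (n + k) * G n))"
      using c_const_pos by (simp add: field_simps)
  qed (use q in simp)
  define E where "E = (\<lambda>n. of_real (w powi n * even_seq (n + k)) * (g (q powi n) + g (- (q powi n))))"
  define D where "D = (\<lambda>n. of_real (w powi n * odd_seq (n + k)) * (g (q powi n) - g (- (q powi n))))"
  have sE: "E summable_on UNIV"
  proof (rule abs_summable_summable[OF Infinite_Sum.abs_summable_on_comparison_test[OF even]])
    fix n
    show "norm (E n) \<le> norm (w powi n * even_seq (n + k) * G n)"
      using norm_triangle_ineq[of "g (q powi n)" "g (- (q powi n))"]
      unfolding E_def G_def norm_mult norm_of_real real_norm_def abs_mult by (intro mult_mono) auto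
  qed
  have sD: "D summable_on UNIV"
  proof (rule abs_summable_summable[OF Infinite_Sum.abs_summable_on_comparison_test[OF odd]])
    fix n
    show "norm (D n) \<le> norm (w powi n * odd_seq (n + k) * G n)"
      using norm_triangle_ineq4[of "g (q powi n)" "g (- (q powi n))"]
      unfolding D_def G_def norm_mult norm_of_real real_norm_def abs_mult by (intro mult_mono) auto
  qed
  have "of_real ?c * (\<Sum>\<^sub>\<infinity>n. (q powi n) *\<^sub>R (h \<zeta> (q powi n) + h \<zeta> (- (q powi n))))
      = (\<Sum>\<^sub>\<infinity>n. E n + \<i> * of_real \<tau> * D n)"
    unfolding infsum_cmult_right'[symmetric]
  proof (rule infsum_cong)
    fix n
    have "of_real ?c * (q powi n) *\<^sub>R (h \<zeta> (q powi n) + h \<zeta> (- (q powi n)))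
        = of_real (?c * q powi n) * h \<zeta> (1 * q powi n) + of_real (?c * q powi n) * h \<zeta> (- 1 * q powi n)"
      by (simp add: scaleR_conv_of_real distrib_left mult.assoc)
    also have "\<dots> = E n + \<i> * of_real \<tau> * D n"
      unfolding summand[of 1, OF disjI1[OF refl]] summand[of "- 1", OF disjI2[OF refl]] E_def D_def
      by (simp add: algebra_simps)
    finally show "of_real ?c * (q powi n) *\<^sub>R (h \<zeta> (q powi n) + h \<zeta> (- (q powi n)))
        = E n + \<i> * of_real \<tau> * D n" .
  qed
  also have "\<dots> = (\<Sum>\<^sub>\<infinity>n. E n) + \<i> * of_real \<tau> * (\<Sum>\<^sub>\<infinity>n. D n)"
    by (subst infsum_add) (auto intro: sE sD summable_on_cmult_right simp: infsum_cmult_right')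
  finally show "of_real (?c / 2) * jackson_integral q (h \<zeta>) = of_real ((1 - q) / 2) *
      ((\<Sum>\<^sub>\<infinity>n. of_real (w powi n * even_seq (n + k)) * (g (q powi n) + g (- (q powi n))))
        + \<i> * of_real \<tau> *
          (\<Sum>\<^sub>\<infinity>n. of_real (w powi n * odd_seq (n + k)) * (g (q powi n) - g (- (q powi n)))))"
    unfolding jackson_integral_def E_def D_def
    by (simp add: scaleR_conv_of_real mult_ac)
qed

subsection \<open>Inversion\<close>

lemma L1_q_iff:
  "f \<in> L1_q \<alpha> q \<longleftrightarrow>
    (\<lambda>n. w powi n * (norm (f (q powi n)) + norm (f (- (q powi n))))) summable_on UNIV"
proof -
  have "q powi n * (norm (norm (f (q powi n)) * \<bar>q powi n\<bar> powr (2 * \<alpha> + 1))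
        + norm (norm (f (- (q powi n))) * \<bar>- (q powi n)\<bar> powr (2 * \<alpha> + 1)))
      = (q powi n * (q powi n) powr (2 * \<alpha> + 1)) * (norm (f (q powi n)) + norm (f (- (q powi n))))" for n
    using q by (simp add: algebra_simps)
  then show ?thesis
    unfolding L1_q_def jackson_integrable_def mem_Collect_eq weight by simp
qed

text \<open>The transform acts separately on even and odd parts, so each is recovered by
  \<open>correlation_inversion\<close> from its own orthogonality relation.\<close>

lemma q_Dunkl_inversion:
  assumes f: "f \<in> L1_q \<alpha> q" and t: "t = 1 \<or> t = - 1" and x: "x = t * q powi l"
  defines "F \<equiv> q_Dunkl_transform \<alpha> q f"
    and "h \<equiv> \<lambda>\<xi>. q_Dunkl_transform \<alpha> q f \<xi> * q_Dunkl_kernel \<alpha> q \<xi> x * of_real (\<bar>\<xi>\<bar> powr (2 * \<alpha> + 1))"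
  shows "jackson_integrable q (q_Dunkl_integrand \<alpha> q f x)"
    and "jackson_integrable q h"
    and "of_real (c_const \<alpha> q / 2) * jackson_integral q h = f x"
proof -
  define G where "G = (\<lambda>n. norm (f (q powi n)) + norm (f (- (q powi n))))"
  have wG: "(\<lambda>n. w powi n * G n) abs_summable_on UNIV"
    using f w(1) by (simp add: L1_q_iff G_def abs_mult)
  obtain A where A: "\<And>k. \<bar>even_seq k\<bar> \<le> A" using even_seq_bounded by blast
  obtain B where B: "\<And>k. \<bar>odd_seq k\<bar> \<le> B" using odd_seq_bounded by blast
  have even: "(\<lambda>n. w powi n * even_seq (n + k) * G n) abs_summable_on UNIV" for k
    using abs_summable_mult_bounded[OF wG, of "\<lambda>n. even_seq (n + k)" A] A by (simp add: mult_ac)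
  have odd: "(\<lambda>n. w powi n * odd_seq (n + k) * G n) abs_summable_on UNIV" for k
    using abs_summable_mult_bounded[OF wG, of "\<lambda>n. odd_seq (n + k)" B] B by (simp add: mult_ac)
  define fp where "fp = (\<lambda>n. f (q powi n) + f (- (q powi n)))"
  define fm where "fm = (\<lambda>n. f (q powi n) - f (- (q powi n)))"
  have fpm: "norm (fp n) \<le> G n" "norm (fm n) \<le> G n" for n
    unfolding fp_def fm_def G_def by (rule norm_triangle_ineq norm_triangle_ineq4)+
  have wf: "(\<lambda>n. of_real (w powi n) * g n) abs_summable_on UNIV"
    if g: "\<And>n. norm (g n) \<le> G n" for g :: "int \<Rightarrow> complex"
  proof (rule Infinite_Sum.abs_summable_on_comparison_test[OF wG])
    fix n
    have "norm (g n) \<le> \<bar>G n\<bar>" using g[of n] by linarith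
    then show "norm (of_real (w powi n) * g n) \<le> norm (w powi n * G n)"
      unfolding norm_mult norm_of_real real_norm_def abs_mult by (intro mult_left_mono) auto
  qed
  define E where "E = (\<lambda>k. \<Sum>\<^sub>\<infinity>n. of_real (w powi n * even_seq (n + k)) * fp n)"
  define D where "D = (\<lambda>k. \<Sum>\<^sub>\<infinity>n. of_real (w powi n * odd_seq (n + k)) * fm n)"
  have forward: "jackson_integrable q (q_Dunkl_integrand \<alpha> q f (s * q powi k)) \<and>
    F (s * q powi k) = of_real ((1 - q) / 2) * (E k - \<i> * of_real s * D k)"
    if "s = 1 \<or> s = - 1" for s k
  proof -
    have "- s = 1 \<or> - s = - 1" "- (s * q powi k) = (- s) * q powi k" using that by auto
    from jackson_integral_q_Dunkl[OF this even[unfolded G_def] odd[unfolded G_def]]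
    show ?thesis
      unfolding F_def q_Dunkl_transform_def E_def D_def fp_def fm_def q_Dunkl_integrand_def[abs_def]
      by simp
  qed
  show "jackson_integrable q (q_Dunkl_integrand \<alpha> q f x)"
    using forward[OF t] x by blast
  have F1: "F (q powi k) = of_real ((1 - q) / 2) * (E k - \<i> * D k)"
    and F2: "F (- (q powi k)) = of_real ((1 - q) / 2) * (E k + \<i> * D k)" for k
    using forward[of 1 k] forward[of "- 1" k] by simp_all
  \<comment> \<open>The even part of \<open>F\<close> depends on \<open>E\<close> only, the odd part
    on \<open>D\<close> only.\<close>
  have Fp: "F (q powi k) + F (- (q powi k)) = of_real (1 - q) * E k"
    and Fm: "F (q powi k) - F (- (q powi k)) = - \<i> * of_real (1 - q) * D k" for k
    unfolding F1 F2 by (simp_all add: field_simps)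
  \<comment> \<open>For the second integral \<open>F\<close> is only shown to be bounded on the
    lattice; absolute convergence then comes from \<open>even_seq_summable\<close> and
    \<open>odd_seq_summable\<close>.\<close>
  define S where "S = (\<Sum>\<^sub>\<infinity>n. norm (w powi n * G n))"
  have bound: "norm (\<Sum>\<^sub>\<infinity>n. of_real (w powi n * e (n + k)) * g n) \<le> C * S"
    if e: "\<And>n. \<bar>e n\<bar> \<le> C" and g: "\<And>n. norm (g n) \<le> G n" for e C k and g :: "int \<Rightarrow> complex"
  proof -
    have C: "0 \<le> C" using e[of 0] by linarith
    have le: "norm (of_real (w powi n * e (n + k)) * g n) \<le> C * norm (w powi n * G n)" for n
    proof -
      have "norm (of_real (w powi n * e (n + k)) * g n) = \<bar>e (n + k)\<bar> * (w powi n * norm (g n))"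
        unfolding norm_mult norm_of_real abs_mult using w(1) by simp
      also have "\<dots> \<le> C * (w powi n * G n)"
        using e[of "n + k"] g[of n] w(1) C by (intro mult_mono) auto
      also have "\<dots> \<le> C * norm (w powi n * G n)"
        using C by (intro mult_left_mono) auto
      finally show ?thesis .
    qed
    have "(\<lambda>n. norm (C * norm (w powi n * G n))) summable_on UNIV"
      using wG C by (simp add: abs_mult summable_on_cmult_right)
    then have "(\<lambda>n. of_real (w powi n * e (n + k)) * g n) abs_summable_on UNIV"
      by (rule Infinite_Sum.abs_summable_on_comparison_test) (use le C in \<open>simp add: abs_mult\<close>)
    then have "norm (\<Sum>\<^sub>\<infinity>n. of_real (w powi n * e (n + k)) * g n) \<le> (\<Sum>\<^sub>\<infinity>n. C * norm (w powi n * G n))"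
      by (intro order.trans[OF norm_infsum_bound] infsum_mono summable_on_cmult_right wG le)
    then show ?thesis by (simp only: infsum_cmult_right' S_def)
  qed
  have E: "norm (E k) \<le> A * S" and D: "norm (D k) \<le> B * S" for k
    unfolding E_def D_def by (rule bound[OF A fpm(1)], rule bound[OF B fpm(2)])
  have FB: "norm (F (q powi k)) + norm (F (- (q powi k))) \<le> (1 - q) * (A * S + B * S)" for k
  proof -
    have "norm (E k - \<i> * D k) \<le> A * S + B * S" "norm (E k + \<i> * D k) \<le> A * S + B * S"
      using norm_triangle_ineq4[of "E k" "\<i> * D k"] norm_triangle_ineq[of "E k" "\<i> * D k"] E[of k] D[of k]
      by (simp_all add: norm_mult)
    then have "(1 - q) / 2 * norm (E k - \<i> * D k) \<le> (1 - q) / 2 * (A * S + B * S)"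
      "(1 - q) / 2 * norm (E k + \<i> * D k) \<le> (1 - q) / 2 * (A * S + B * S)"
      using q by (auto intro!: mult_left_mono)
    moreover have scale: "norm (of_real ((1 - q) / 2) * z) = (1 - q) / 2 * norm z" for z :: complex
      using q by (simp only: norm_mult norm_of_real) simp
    ultimately show ?thesis
      unfolding F1 F2 scale by argo
  qed
  define H where "H = (\<lambda>k. norm (F (q powi k)) + norm (F (- (q powi k))))"
  have H: "norm (H k) \<le> (1 - q) * (A * S + B * S)" for k
    using FB[of k] by (simp add: H_def)
  have h: "h = (\<lambda>\<xi>. F \<xi> * q_Dunkl_kernel \<alpha> q x \<xi> * of_real (\<bar>\<xi>\<bar> powr (2 * \<alpha> + 1)))"
    unfolding h_def F_def by (simp add: q_Dunkl_kernel_commute)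
  note backward = jackson_integral_q_Dunkl[OF t x, of F, folded h,
      OF abs_summable_mult_bounded[where v = H, OF even_seq_summable H, unfolded H_def]
        abs_summable_mult_bounded[where v = H, OF odd_seq_summable H, unfolded H_def]]
  show "jackson_integrable q h" by (rule backward(1))
  have "of_real (c_const \<alpha> q / 2) * jackson_integral q h = of_real ((1 - q) / 2) *
      ((\<Sum>\<^sub>\<infinity>k. of_real (1 - q) * (of_real (w powi k * even_seq (k + l)) * E k)) + \<i> * of_real t *
        (\<Sum>\<^sub>\<infinity>k. (- \<i> * of_real (1 - q)) * (of_real (w powi k * odd_seq (k + l)) * D k)))"
    unfolding backward(2) Fp Fm by (simp only: mult_ac)
  also have "\<dots> = (of_real ((1 - q)\<^sup>2) * (\<Sum>\<^sub>\<infinity>k. of_real (w powi k * even_seq (k + l)) * E k)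
      + of_real t * (of_real ((1 - q)\<^sup>2) * (\<Sum>\<^sub>\<infinity>k. of_real (w powi k * odd_seq (k + l)) * D k))) / 2"
  proof -
    \<comment> \<open>The factor \<i> of the inverse kernel meets the - \<i> of the transform, so
      both parts return with sign plus and the same constant.\<close>
    have "r / 2 * (r * X + \<i> * s * (- \<i> * r * Y)) = (r\<^sup>2 * X + s * (r\<^sup>2 * Y)) / 2" for r s X Y :: complex
      by (simp add: power2_eq_square algebra_simps)
    from this[of "of_real (1 - q)"] show ?thesis
      unfolding infsum_cmult_right' by (simp only: of_real_divide of_real_numeral of_real_power)
  qed
  also have "\<dots> = (fp l + of_real t * fm l) / 2"
  proof -
    have W: "w powi n \<noteq> 0" for n using w(1) by simp
    show ?thesis
      unfolding E_def D_def
        correlation_inversion[OF A W even_seq_summable wf[OF fpm(1)] even_seq_orthogonality]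
        correlation_inversion[OF B W odd_seq_summable wf[OF fpm(2)] odd_seq_orthogonality] ..
  qed
  also have "\<dots> = f x"
    using t by (auto simp: x fp_def fm_def)
  finally show "of_real (c_const \<alpha> q / 2) * jackson_integral q h = f x" .
qed

end

section \<open>Complex conjugation and the inversion theorem\<close>

lemma jackson_integral_cnj: "jackson_integral q (\<lambda>x. cnj (f x)) = cnj (jackson_integral q f)"
proof -
  have "(\<Sum>\<^sub>\<infinity>n. (q powi n) *\<^sub>R (cnj (f (q powi n)) + cnj (f (- (q powi n)))))
      = cnj (\<Sum>\<^sub>\<infinity>n. (q powi n) *\<^sub>R (f (q powi n) + f (- (q powi n))))"
    unfolding infsum_cnj[symmetric] by (intro infsum_cong) simp
  then show ?thesis
    unfolding jackson_integral_def by (simp only: complex_cnj_scaleR)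
qed

theorem theorem10:
  fixes q \<alpha> x :: real and f :: "real \<Rightarrow> complex"
  assumes "0 < q" and "q < 1"
    and "\<exists>m::int. ln (1 - q) / ln q = 2 * of_int m"
    and "\<alpha> \<ge> - 1 / 2"
    and "f \<in> L1_q \<alpha> q"
    and "x \<in> R_q q"
  shows "(\<forall>\<xi>\<in>R_q q. jackson_integrable q (q_Dunkl_integrand \<alpha> q f \<xi>))
    \<and> jackson_integrable q
        (\<lambda>\<xi>. q_Dunkl_transform \<alpha> q f \<xi> * q_Dunkl_kernel \<alpha> q \<xi> x
              * of_real (\<bar>\<xi>\<bar> powr (2 * \<alpha> + 1)))
    \<and> jackson_integrable q
        (q_Dunkl_integrand \<alpha> q (\<lambda>\<xi>. cnj (q_Dunkl_transform \<alpha> q f \<xi>)) x)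
    \<and> f x = of_real (c_const \<alpha> q / 2) * jackson_integral q
        (\<lambda>\<xi>. q_Dunkl_transform \<alpha> q f \<xi> * q_Dunkl_kernel \<alpha> q \<xi> x
              * of_real (\<bar>\<xi>\<bar> powr (2 * \<alpha> + 1)))
    \<and> of_real (c_const \<alpha> q / 2) * jackson_integral q
        (\<lambda>\<xi>. q_Dunkl_transform \<alpha> q f \<xi> * q_Dunkl_kernel \<alpha> q \<xi> x
              * of_real (\<bar>\<xi>\<bar> powr (2 * \<alpha> + 1)))
      = cnj (q_Dunkl_transform \<alpha> q (\<lambda>\<xi>. cnj (q_Dunkl_transform \<alpha> q f \<xi>)) x)"
proof -
  let ?h = "\<lambda>\<xi>. q_Dunkl_transform \<alpha> q f \<xi> * q_Dunkl_kernel \<alpha> q \<xi> x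
              * of_real (\<bar>\<xi>\<bar> powr (2 * \<alpha> + 1))"
  obtain m :: int where m: "ln (1 - q) / ln q = 2 * of_int m"
    using assms(3) by blast
  \<comment> \<open>The condition on the logarithms makes \<open>1 - q\<close> an integral power of
    \<open>q\<close>; the locale is entered with exponent \<open>2 * m\<close>.\<close>
  have "ln q < 0" using assms(1,2) by (simp add: ln_less_zero)
  then have "ln (1 - q) = of_int (2 * m) * ln q"
    using m by (simp add: field_simps)
  then have "exp (ln (1 - q)) = q powr of_int (2 * m)"
    using assms(1) by (simp add: powr_def)
  then have lattice: "1 - q = q powi (2 * m)"
    using assms(1,2) by (subst (asm) powr_real_of_int') auto
  interpret q_Dunkl_lattice q \<alpha> "2 * m"
    by standard (use assms lattice in auto)
  have R_q: "\<exists>t l. (t = 1 \<or> t = - 1) \<and> \<xi> = t * q powi l" if "\<xi> \<in> R_q q" for \<xi>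
    using that unfolding R_q_def by force
  \<comment> \<open>The kernel depends on the product of its arguments, and conjugation flips the
    sign of that product. Hence the integrand of the second transform is the conjugate of the
    inversion integrand.\<close>
  have cnj_eq: "q_Dunkl_integrand \<alpha> q (\<lambda>\<xi>. cnj (q_Dunkl_transform \<alpha> q f \<xi>)) x = (\<lambda>\<xi>. cnj (?h \<xi>))"
    by (simp add: q_Dunkl_integrand_def[abs_def] cnj_q_Dunkl_kernel q_Dunkl_kernel_commute[of \<alpha> q _ x]
        q_Dunkl_kernel_commute[of \<alpha> q "- x"])
  from R_q[OF assms(6)] obtain t l where "t = 1 \<or> t = - 1" "x = t * q powi l" by blast
  note inversion = q_Dunkl_inversion[OF assms(5) this]
  have "\<forall>\<xi>\<in>R_q q. jackson_integrable q (q_Dunkl_integrand \<alpha> q f \<xi>)"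
    using R_q q_Dunkl_inversion(1)[OF assms(5)] by blast
  moreover have "jackson_integrable q (q_Dunkl_integrand \<alpha> q (\<lambda>\<xi>. cnj (q_Dunkl_transform \<alpha> q f \<xi>)) x)"
    using inversion(2) unfolding cnj_eq jackson_integrable_def complex_mod_cnj .
  moreover have "of_real (c_const \<alpha> q / 2) * jackson_integral q ?h
      = cnj (q_Dunkl_transform \<alpha> q (\<lambda>\<xi>. cnj (q_Dunkl_transform \<alpha> q f \<xi>)) x)"
    unfolding q_Dunkl_transform_def[of \<alpha> q "\<lambda>\<xi>. cnj (q_Dunkl_transform \<alpha> q f \<xi>)"] cnj_eq
      jackson_integral_cnj by simp
  ultimately show ?thesis
    using inversion(2,3) by metis
qed

end
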